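(* Let $d=d_1+\cdots+d_r\geq 2$ and let $d_\ell:=\min\{d_1,\ldots,d_r\}$. For a geodesic $\gamma$ of $\mathbb X_{\mathbf n,\mathbf d}$ parametrized by arc length, define its curvature at $t$ as $\kappa_\gamma(t):=\|P_{\gamma(t)}(\gamma''(t))\|$, where $P_{\gamma(t)}$ is the orthogonal projection onto the normal space $N_{\gamma(t)}\mathbb X_{\mathbf n,\mathbf d}$. Then for every such geodesic and every $t$, $$\sqrt{\tfrac{2(d_\ell-1)}{d_\ell}}\;\leq\;\kappa_\gamma(t)\;\leq\;\sqrt{\tfrac{2(d-1)}{d}}.$$ The upper bound is attained by the geodesics $\gamma=\gamma_1\otimes\cdots\otimes\gamma_r$ where each $\gamma_i$ is a geodesic of $\mathbb V_{n_i,d_i}$ of constant speed $\|\gamma_i'(t)\|=\sqrt{d_i/d}$. The lower bound is attained by the geodesics $\gamma=\gamma_1\otimes\cdots\otimes\gamma_r$ where $\gamma_\ell$ is a geodesic of $\mathbb V_{n_\ell,d_\ell}$ parametrized by arc length and all other $\gamma_i$ are constant.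
   Context: $H_{n,d}$ is the space of real homogeneous polynomials of degree $d$ in $x_0,\ldots,x_n$ with the Bombieri–Weyl inner product (the scaled monomials $\mathbf m_\alpha=\sqrt{\binom{d}{\alpha}}x^\alpha$ are orthonormal). $\mathbb V_{n,d}:=\{\pm\ell^d:\ell\text{ linear form}\}\cap\{\|f\|=1\}$. $\mathscr H_{\mathbf n,\mathbf d}:=H_{n_1,d_1}\otimes\cdots\otimes H_{n_r,d_r}$ with inner product $\langle f_1\otimes\cdots\otimes f_r,g_1\otimes\cdots\otimes g_r\rangle=\prod_i\langle f_i,g_i\rangle$, and $\mathbb X_{\mathbf n,\mathbf d}:=\{f_1\otimes\cdots\otimes f_r:f_i\in\mathbb V_{n_i,d_i}\}$, a smooth submanifold of the unit sphere $\mathbb S(\mathscr H_{\mathbf n,\mathbf d})$ with the induced Riemannian metric. For $G\in\mathbb X_{\mathbf n,\mathbf d}$, the normal space $N_G\mathbb X_{\mathbf n,\mathbf d}$ is the orthogonal complement of $T_G\mathbb X_{\mathbf n,\mathbf d}$ inside $T_G\mathbb S(\mathscr H_{\mathbf n,\mathbf d})=G^\perp$. *)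

theory Defs
  imports "HOL-Analysis.Analysis"
begin

definition coord_space :: "'i set \<Rightarrow> ('i \<Rightarrow> real) set" where
  "coord_space S = {F. \<forall>A. A \<notin> S \<longrightarrow> F A = 0}"

definition ip :: "'i set \<Rightarrow> ('i \<Rightarrow> real) \<Rightarrow> ('i \<Rightarrow> real) \<Rightarrow> ('i \<Rightarrow> real) \<Rightarrow> real" where
  "ip S w F G = (\<Sum>A\<in>S. w A * F A * G A)"

definition nrm :: "'i set \<Rightarrow> ('i \<Rightarrow> real) \<Rightarrow> ('i \<Rightarrow> real) \<Rightarrow> real" where
  "nrm S w F = sqrt (ip S w F F)"

definition smooth_curve :: "real set \<Rightarrow> (real \<Rightarrow> 'i \<Rightarrow> real) \<Rightarrow> bool" where
  "smooth_curve I \<gamma> = (\<forall>A k. \<forall>t\<in>I. ((deriv ^^ k) (\<lambda>s. \<gamma> s A)) differentiable (at t))"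

definition vel :: "(real \<Rightarrow> 'i \<Rightarrow> real) \<Rightarrow> real \<Rightarrow> 'i \<Rightarrow> real" where
  "vel \<gamma> t = (\<lambda>A. deriv (\<lambda>s. \<gamma> s A) t)"

definition acc :: "(real \<Rightarrow> 'i \<Rightarrow> real) \<Rightarrow> real \<Rightarrow> 'i \<Rightarrow> real" where
  "acc \<gamma> t = (\<lambda>A. deriv (deriv (\<lambda>s. \<gamma> s A)) t)"

definition tangent_space :: "('i \<Rightarrow> real) set \<Rightarrow> ('i \<Rightarrow> real) \<Rightarrow> ('i \<Rightarrow> real) set" where
  "tangent_space M G = {vel c 0 | c e. 0 < e \<and> smooth_curve (ball 0 e) c \<and>
       (\<forall>s\<in>ball 0 e. c s \<in> M) \<and> c 0 = G}"

text \<open>Normal space: orthogonal complement of the tangent space inside G-perp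
  (= tangent space of the unit sphere at G).\<close>
definition normal_space :: "'i set \<Rightarrow> ('i \<Rightarrow> real) \<Rightarrow> ('i \<Rightarrow> real) set \<Rightarrow> ('i \<Rightarrow> real) \<Rightarrow> ('i \<Rightarrow> real) set" where
  "normal_space S w M G = {v \<in> coord_space S. ip S w v G = 0 \<and> (\<forall>u\<in>tangent_space M G. ip S w v u = 0)}"

definition proj :: "'i set \<Rightarrow> ('i \<Rightarrow> real) \<Rightarrow> ('i \<Rightarrow> real) set \<Rightarrow> ('i \<Rightarrow> real) \<Rightarrow> ('i \<Rightarrow> real)" where
  "proj S w N v = (THE p. p \<in> N \<and> (\<forall>u\<in>N. ip S w (\<lambda>A. v A - p A) u = 0))"

definition geodesic :: "'i set \<Rightarrow> ('i \<Rightarrow> real) \<Rightarrow> ('i \<Rightarrow> real) set \<Rightarrow> real set \<Rightarrow> (real \<Rightarrow> 'i \<Rightarrow> real) \<Rightarrow> bool" where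
  "geodesic S w M I \<gamma> = (open I \<and> smooth_curve I \<gamma> \<and> (\<forall>t\<in>I. \<gamma> t \<in> M) \<and>
      (\<forall>t\<in>I. \<forall>u\<in>tangent_space M (\<gamma> t). ip S w (acc \<gamma> t) u = 0))"

definition curvature :: "'i set \<Rightarrow> ('i \<Rightarrow> real) \<Rightarrow> ('i \<Rightarrow> real) set \<Rightarrow> (real \<Rightarrow> 'i \<Rightarrow> real) \<Rightarrow> real \<Rightarrow> real" where
  "curvature S w M \<gamma> t = nrm S w (proj S w (normal_space S w M (\<gamma> t)) (acc \<gamma> t))"

text \<open>A homogeneous polynomial of degree d in x_0..x_n is its coefficient
  function on exponent vectors alpha (alpha i = 0 for i > n, total degree d).\<close>
definition Mon :: "nat \<Rightarrow> nat \<Rightarrow> (nat \<Rightarrow> nat) set" where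
  "Mon n d = {\<alpha>. (\<forall>i>n. \<alpha> i = 0) \<and> (\<Sum>i\<le>n. \<alpha> i) = d}"

definition multinom :: "nat \<Rightarrow> nat \<Rightarrow> (nat \<Rightarrow> nat) \<Rightarrow> real" where
  "multinom n d \<alpha> = fact d / (\<Prod>i\<le>n. fact (\<alpha> i))"

text \<open>Bombieri--Weyl weights: <x^a, x^b> = delta_ab / multinom(d;a).\<close>
definition bw_w :: "nat \<Rightarrow> nat \<Rightarrow> (nat \<Rightarrow> nat) \<Rightarrow> real" where
  "bw_w n d \<alpha> = 1 / multinom n d \<alpha>"

text \<open>Coefficients of l^d where l = sum_{i<=n} a_i x_i.\<close>
definition ver :: "nat \<Rightarrow> nat \<Rightarrow> (nat \<Rightarrow> real) \<Rightarrow> (nat \<Rightarrow> nat) \<Rightarrow> real" where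
  "ver n d a = (\<lambda>\<alpha>. if \<alpha> \<in> Mon n d then multinom n d \<alpha> * (\<Prod>i\<le>n. a i ^ \<alpha> i) else 0)"

definition Vset :: "nat \<Rightarrow> nat \<Rightarrow> ((nat \<Rightarrow> nat) \<Rightarrow> real) set" where
  "Vset n d = {F. \<exists>a s. (s = 1 \<or> s = -1) \<and> F = (\<lambda>\<alpha>. s * ver n d a \<alpha>) \<and>
                   nrm (Mon n d) (bw_w n d) F = 1}"

text \<open>Factors indexed by i < r with parameters n i, d i. Tensor coordinates are
  lists of exponent vectors, one per factor.\<close>
definition Idx :: "nat \<Rightarrow> (nat \<Rightarrow> nat) \<Rightarrow> (nat \<Rightarrow> nat) \<Rightarrow> (nat \<Rightarrow> nat) list set" where
  "Idx r n d = {A. length A = r \<and> (\<forall>i<r. A ! i \<in> Mon (n i) (d i))}"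

definition tw :: "nat \<Rightarrow> (nat \<Rightarrow> nat) \<Rightarrow> (nat \<Rightarrow> nat) \<Rightarrow> (nat \<Rightarrow> nat) list \<Rightarrow> real" where
  "tw r n d A = (\<Prod>i<r. bw_w (n i) (d i) (A ! i))"

definition tensor :: "nat \<Rightarrow> (nat \<Rightarrow> nat) \<Rightarrow> (nat \<Rightarrow> nat) \<Rightarrow> (nat \<Rightarrow> (nat \<Rightarrow> nat) \<Rightarrow> real)
      \<Rightarrow> (nat \<Rightarrow> nat) list \<Rightarrow> real" where
  "tensor r n d fs = (\<lambda>A. if A \<in> Idx r n d then (\<Prod>i<r. fs i (A ! i)) else 0)"

definition Xset :: "nat \<Rightarrow> (nat \<Rightarrow> nat) \<Rightarrow> (nat \<Rightarrow> nat) \<Rightarrow> ((nat \<Rightarrow> nat) list \<Rightarrow> real) set" where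
  "Xset r n d = {tensor r n d fs | fs. \<forall>i<r. fs i \<in> Vset (n i) (d i)}"

end

theory Submission
  imports Defs
begin

text \<open>
  The Bombieri--Weyl product satisfies \<open>\<langle>a^d, b^d\<rangle> = (a \<cdot> b)^d\<close>. Near a point
  \<open>\<gamma>(t\<^sub>0) = \<epsilon> e\<^sub>1^d\<^sub>1 \<otimes> \<dots> \<otimes> e\<^sub>r^d\<^sub>r\<close> a curve can be written as
  \<open>\<gamma> = \<epsilon> h x\<^sub>1^d\<^sub>1 \<otimes> \<dots> \<otimes> x\<^sub>r^d\<^sub>r\<close> with \<open>x\<^sub>i \<cdot> e\<^sub>i = 1\<close> and \<open>h = \<langle>\<gamma>, \<gamma>(t\<^sub>0)\<rangle>\<close>, where
  \<open>h x\<^sub>i\<close> is linear in \<open>\<gamma>\<close>. All inner products of derivatives are read off from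
  \<open>h(s) h(t) \<Prod>\<^sub>i (x\<^sub>i(s) \<cdot> x\<^sub>i(t))^d\<^sub>i\<close>. Thus \<open>\<gamma>''(t\<^sub>0)\<close> is orthogonal to the
  tangent space iff all \<open>x\<^sub>i''(t\<^sub>0)\<close> vanish, and then, with \<open>\<theta>\<^sub>i = |x\<^sub>i'(t\<^sub>0)|\<^sup>2\<close>, unit speed means
  \<open>\<Sum> d\<^sub>i \<theta>\<^sub>i = 1\<close>, the normal part of \<open>\<gamma>''\<close> is \<open>\<gamma>'' + \<gamma>\<close>, and the squared curvature is
  \<open>2 - 2 \<Sum> d\<^sub>i \<theta>\<^sub>i\<^sup>2\<close>. The bounds are \<open>1/d \<le> \<Sum> d\<^sub>i \<theta>\<^sub>i\<^sup>2 \<le> 1/d\<^sub>l\<close>.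
\<close>

section \<open>Multinomial theorem and the Bombieri--Weyl inner product\<close>

definition dot :: "nat \<Rightarrow> (nat \<Rightarrow> real) \<Rightarrow> (nat \<Rightarrow> real) \<Rightarrow> real" where
  "dot n a b = (\<Sum>k\<le>n. a k * b k)"

lemma dot_commute: "dot n a b = dot n b a"
  by (simp add: dot_def mult.commute)

lemma Mon_0: "Mon 0 d = {\<lambda>i. if i = 0 then d else 0}"
  by (auto simp: Mon_def fun_eq_iff)

text \<open>Splitting off the exponent \<open>k\<close> of the last variable leaves a monomial of
  degree \<open>d - k\<close> in the remaining ones; this drives the induction on the number of
  variables.\<close>

lemma Mon_Suc:
  "Mon (Suc n) d = (\<lambda>(k, \<beta>). \<beta>(Suc n := k)) ` (SIGMA k:{..d}. Mon n (d - k))"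
proof (intro equalityI subsetI)
  fix \<alpha> assume a: "\<alpha> \<in> Mon (Suc n) d"
  have "\<alpha> = (\<lambda>(k, \<beta>). \<beta>(Suc n := k)) (\<alpha> (Suc n), \<alpha>(Suc n := 0))" by simp
  moreover have "(\<alpha> (Suc n), \<alpha>(Suc n := 0)) \<in> (SIGMA k:{..d}. Mon n (d - k))"
  proof -
    have "(\<Sum>i\<le>n. (\<alpha>(Suc n := 0)) i) = (\<Sum>i\<le>n. \<alpha> i)" by (rule sum.cong) auto
    then show ?thesis using a by (auto simp: Mon_def not_less_eq less_Suc_eq)
  qed
  ultimately show "\<alpha> \<in> (\<lambda>(k, \<beta>). \<beta>(Suc n := k)) ` (SIGMA k:{..d}. Mon n (d - k))" by (rule image_eqI)
next
  fix \<alpha> assume "\<alpha> \<in> (\<lambda>(k, \<beta>). \<beta>(Suc n := k)) ` (SIGMA k:{..d}. Mon n (d - k))"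
  then obtain k \<beta> where k: "k \<le> d" "\<beta> \<in> Mon n (d - k)" "\<alpha> = \<beta>(Suc n := k)" by auto
  have "(\<Sum>i\<le>n. (\<beta>(Suc n := k)) i) = (\<Sum>i\<le>n. \<beta> i)" by (rule sum.cong) auto
  then show "\<alpha> \<in> Mon (Suc n) d" using k by (auto simp: Mon_def)
qed

lemma finite_Mon: "finite (Mon n d)"
  by (induction n arbitrary: d) (auto simp: Mon_0 Mon_Suc)

text \<open>Induction on the number of variables: the binomial theorem peels off
  \<open>c (Suc n)\<close>, and a multinomial coefficient is a binomial coefficient times a
  multinomial coefficient in one variable less.\<close>

lemma multinomial_theorem:
  fixes c :: "nat \<Rightarrow> real"
  shows "(\<Sum>i\<le>n. c i) ^ d = (\<Sum>\<alpha>\<in>Mon n d. multinom n d \<alpha> * (\<Prod>i\<le>n. c i ^ \<alpha> i))"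
proof (induction n arbitrary: d)
  case 0
  show ?case by (simp add: Mon_0 multinom_def)
next
  case (Suc n)
  let ?f = "\<lambda>\<alpha>. multinom (Suc n) d \<alpha> * (\<Prod>i\<le>Suc n. c i ^ \<alpha> i)"
  \<comment> \<open>The entry at \<open>Suc n\<close> recovers \<open>k\<close>; the rest of
    \<open>\<beta>\<close> is recovered because \<open>\<beta>\<close> itself vanishes
    there.\<close>
  have inj: "inj_on (\<lambda>(k, \<beta>). \<beta>(Suc n := k)) (SIGMA k:{..d}. Mon n (d - k))"
  proof (rule inj_onI, clarsimp)
    fix k \<beta> k' \<beta>' assume b: "\<beta> \<in> Mon n (d - k)" "\<beta>' \<in> Mon n (d - k')"
      and e: "\<beta>(Suc n := k) = \<beta>'(Suc n := k')"
    have "\<beta> i = \<beta>' i" for i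
      using fun_cong[OF e, of i] b by (cases "i = Suc n") (auto simp: Mon_def)
    then show "k = k' \<and> \<beta> = \<beta>'" using fun_cong[OF e, of "Suc n"] by auto
  qed
  have step: "?f (\<beta>(Suc n := k)) =
      real (d choose k) * c (Suc n) ^ k * (multinom n (d - k) \<beta> * (\<Prod>i\<le>n. c i ^ \<beta> i))"
    if "k \<le> d" for k \<beta>
  proof -
    have p: "(\<Prod>i\<le>n. fact ((\<beta>(Suc n := k)) i)) = (\<Prod>i\<le>n. fact (\<beta> i) :: real)"
      "(\<Prod>i\<le>n. c i ^ (\<beta>(Suc n := k)) i) = (\<Prod>i\<le>n. c i ^ \<beta> i)"
      by (auto intro!: prod.cong)
    show ?thesis
      unfolding multinom_def prod.atMost_Suc p using that
      by (simp add: binomial_fact field_simps)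
  qed
  have "(\<Sum>i\<le>Suc n. c i) ^ d = (c (Suc n) + (\<Sum>i\<le>n. c i)) ^ d"
    by (simp add: add.commute)
  also have "\<dots> = (\<Sum>k\<le>d. real (d choose k) * c (Suc n) ^ k * (\<Sum>i\<le>n. c i) ^ (d - k))"
    by (rule binomial_ring)
  also have "\<dots> = (\<Sum>k\<le>d. \<Sum>\<beta>\<in>Mon n (d - k). ?f (\<beta>(Suc n := k)))"
    unfolding Suc sum_distrib_left by (intro sum.cong refl step[symmetric]) simp
  also have "\<dots> = (\<Sum>(k, \<beta>)\<in>(SIGMA k:{..d}. Mon n (d - k)). ?f (\<beta>(Suc n := k)))"
    by (rule sum.Sigma) (auto simp: finite_Mon)
  also have "\<dots> = (\<Sum>\<alpha>\<in>Mon (Suc n) d. ?f \<alpha>)"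
    unfolding Mon_Suc by (subst sum.reindex[OF inj]) (auto simp: case_prod_unfold)
  finally show ?case .
qed

lemma multinom_pos: "multinom n d \<alpha> > 0"
  by (simp add: multinom_def prod_pos)

text \<open>The weight cancels one of the two multinomial coefficients, and what remains is the
  multinomial expansion of the power of \<open>dot n a b\<close>. This reproducing identity is the
  source of every later inner product.\<close>

lemma ip_ver: "ip (Mon n d) (bw_w n d) (ver n d a) (ver n d b) = dot n a b ^ d"
proof -
  have "bw_w n d \<alpha> * ver n d a \<alpha> * ver n d b \<alpha> = multinom n d \<alpha> * (\<Prod>i\<le>n. (a i * b i) ^ \<alpha> i)"
    if "\<alpha> \<in> Mon n d" for \<alpha>
    using that multinom_pos[of n d \<alpha>]
    by (simp add: bw_w_def ver_def power_mult_distrib prod.distrib)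
  then show ?thesis unfolding ip_def dot_def multinomial_theorem by (intro sum.cong) auto
qed

lemma ver_scale: "ver n d (\<lambda>k. c * a k) = (\<lambda>\<alpha>. c ^ d * ver n d a \<alpha>)"
proof
  fix \<alpha>
  have "(\<Prod>i\<le>n. c ^ \<alpha> i) = c ^ d" if "\<alpha> \<in> Mon n d"
    using that by (simp add: power_sum[symmetric] Mon_def)
  then show "ver n d (\<lambda>k. c * a k) \<alpha> = c ^ d * ver n d a \<alpha>"
    by (simp add: ver_def power_mult_distrib prod.distrib)
qed

lemma ver_cong: "(\<And>k. k \<le> n \<Longrightarrow> a k = b k) \<Longrightarrow> ver n d a = ver n d b"
  by (auto simp: ver_def fun_eq_iff intro!: prod.cong)

section \<open>Tensor coordinates and factorization of inner products\<close>

text \<open>Lists are traded for extensional functions so that distributivity of a product over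
  sums, \<open>prod_sum_PiE\<close>, becomes applicable.\<close>

lemma Idx_bij:
  "bij_betw (\<lambda>A. \<lambda>i\<in>{..<r}. A ! i) (Idx r n d) (PiE {..<r} (\<lambda>i. Mon (n i) (d i)))"
proof (rule bij_betw_byWitness[where f' = "\<lambda>g. map g [0..<r]"])
  show "\<forall>A\<in>Idx r n d. map (\<lambda>i\<in>{..<r}. A ! i) [0..<r] = A"
    by (auto simp: Idx_def intro!: nth_equalityI)
  show "\<forall>g\<in>PiE {..<r} (\<lambda>i. Mon (n i) (d i)). (\<lambda>i\<in>{..<r}. map g [0..<r] ! i) = g"
    by (auto simp: fun_eq_iff restrict_def PiE_def extensional_def)
  show "(\<lambda>A. \<lambda>i\<in>{..<r}. A ! i) ` Idx r n d \<subseteq> PiE {..<r} (\<lambda>i. Mon (n i) (d i))"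
    by (simp add: image_subset_iff PiE_iff Idx_def)
  show "(\<lambda>g. map g [0..<r]) ` PiE {..<r} (\<lambda>i. Mon (n i) (d i)) \<subseteq> Idx r n d"
    by (simp add: image_subset_iff PiE_iff Idx_def)
qed

lemma finite_Idx: "finite (Idx r n d)"
  using bij_betw_finite[OF Idx_bij] by (simp add: finite_PiE finite_Mon)

lemma sum_Idx_prod:
  fixes f :: "nat \<Rightarrow> (nat \<Rightarrow> nat) \<Rightarrow> real"
  shows "(\<Sum>A\<in>Idx r n d. \<Prod>i<r. f i (A ! i)) = (\<Prod>i<r. \<Sum>\<alpha>\<in>Mon (n i) (d i). f i \<alpha>)"
proof -
  have "(\<Sum>A\<in>Idx r n d. \<Prod>i<r. f i (A ! i)) =
      (\<Sum>A\<in>Idx r n d. \<Prod>i<r. f i ((\<lambda>i\<in>{..<r}. A ! i) i))" by simp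
  also have "\<dots> = (\<Sum>g\<in>PiE {..<r} (\<lambda>i. Mon (n i) (d i)). \<Prod>i<r. f i (g i))"
    by (rule sum.reindex_bij_betw[OF Idx_bij])
  also have "\<dots> = (\<Prod>i<r. \<Sum>\<alpha>\<in>Mon (n i) (d i). f i \<alpha>)"
    by (rule prod_sum_PiE[symmetric]) (auto simp: finite_Mon)
  finally show ?thesis .
qed

text \<open>Weights and coordinates are products over the factors, so each summand has the shape
  required by \<open>sum_Idx_prod\<close>.\<close>

lemma ip_tensor:
  "ip (Idx r n d) (tw r n d) (tensor r n d f) (tensor r n d g) =
   (\<Prod>i<r. ip (Mon (n i) (d i)) (bw_w (n i) (d i)) (f i) (g i))"
  unfolding ip_def sum_Idx_prod[symmetric]
  by (rule sum.cong) (auto simp: tensor_def tw_def prod.distrib)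

lemma tensor_cong: "(\<And>i. i < r \<Longrightarrow> f i = g i) \<Longrightarrow> tensor r n d f = tensor r n d g"
  by (auto simp: tensor_def fun_eq_iff intro!: prod.cong)

lemma tensor_scale:
  "tensor r n d (\<lambda>i \<alpha>. c i * f i \<alpha>) = (\<lambda>A. (\<Prod>i<r. c i) * tensor r n d f A)"
  by (auto simp: tensor_def fun_eq_iff prod.distrib)

lemma ip_tensor_ver:
  "ip (Idx r n d) (tw r n d) (tensor r n d (\<lambda>i. ver (n i) (d i) (a i)))
     (tensor r n d (\<lambda>i. ver (n i) (d i) (b i))) = (\<Prod>i<r. dot (n i) (a i) (b i) ^ d i)"
  by (simp add: ip_tensor ip_ver)

lemma ip_commute: "ip S w F G = ip S w G F"
  by (simp add: ip_def mult_ac)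

lemma ip_scale_left: "ip S w (\<lambda>A. c * F A) G = c * ip S w F G"
  by (simp add: ip_def sum_distrib_left mult_ac)

lemma ip_scale_right: "ip S w F (\<lambda>A. c * G A) = c * ip S w F G"
  by (simp add: ip_def sum_distrib_left mult_ac)

lemma ip_add_left: "ip S w (\<lambda>A. F A + F' A) G = ip S w F G + ip S w F' G"
  by (simp add: ip_def sum.distrib algebra_simps)

lemma ip_diff_left: "ip S w (\<lambda>A. F A - F' A) G = ip S w F G - ip S w F' G"
  by (simp add: ip_def sum_subtractf algebra_simps)

subsection \<open>Second order jets\<close>

text \<open>A second order Taylor datum as a relation. The first derivative is required on a
  neighbourhood so that differentiating it again makes sense, and the relation composes under
  algebraic operations without side conditions on \<open>deriv\<close>.\<close>

definition jet2 :: "(real \<Rightarrow> real) \<Rightarrow> real \<Rightarrow> real \<Rightarrow> real \<Rightarrow> real \<Rightarrow> bool" where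
  "jet2 f t a b c \<longleftrightarrow> f t = a \<and> (\<exists>f'. (\<forall>\<^sub>F s in nhds t. (f has_real_derivative f' s) (at s)) \<and>
     f' t = b \<and> (f' has_real_derivative c) (at t))"

lemma jet2_value: "jet2 f t a b c \<Longrightarrow> f t = a"
  by (simp add: jet2_def)

lemma jet2_DERIV: "jet2 f t a b c \<Longrightarrow> (f has_real_derivative b) (at t)"
  unfolding jet2_def using eventually_nhds_x_imp_x by blast

text \<open>The two first derivatives agree near \<open>t\<close>, hence so do their derivatives at
  \<open>t\<close>. Inner products are later obtained by computing the jet of one scalar function in
  two ways and comparing coefficients.\<close>

lemma jet2_unique:
  assumes "jet2 f t a b c" "jet2 f t a' b' c'"
  shows "a = a'" "b = b'" "c = c'"
proof -
  from assms obtain f' g' where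
    f: "\<forall>\<^sub>F s in nhds t. (f has_real_derivative f' s) (at s)" "f' t = b" "(f' has_real_derivative c) (at t)"
    and g: "\<forall>\<^sub>F s in nhds t. (f has_real_derivative g' s) (at s)" "g' t = b'" "(g' has_real_derivative c') (at t)"
    unfolding jet2_def by blast
  have e: "\<forall>\<^sub>F s in nhds t. f' s = g' s"
    using f(1) g(1) by eventually_elim (rule DERIV_unique)
  have "(g' has_real_derivative c) (at t)"
    using f(3) DERIV_cong_ev[OF refl e refl] by simp
  then show "c = c'" using g(3) by (rule DERIV_unique)
  show "b = b'" using eventually_nhds_x_imp_x[OF e] f g by simp
  show "a = a'" using assms by (simp add: jet2_def)
qed

lemma jet2_cong:
  assumes "\<forall>\<^sub>F s in nhds t. f s = g s" "jet2 f t a b c"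
  shows "jet2 g t a b c"
proof -
  from assms obtain f' where
    f: "\<forall>\<^sub>F s in nhds t. (f has_real_derivative f' s) (at s)" "f' t = b" "(f' has_real_derivative c) (at t)"
    unfolding jet2_def by blast
  \<comment> \<open>Transferring the derivative at a nearby point \<open>s\<close> takes equality on
    a whole neighbourhood of \<open>s\<close>, not only at \<open>s\<close>.\<close>
  have "\<forall>\<^sub>F s in nhds t. \<forall>\<^sub>F x in nhds s. f x = g x"
    using assms(1) by (simp add: eventually_eventually)
  with f(1) have "\<forall>\<^sub>F s in nhds t. (g has_real_derivative f' s) (at s)"
    by eventually_elim (metis DERIV_cong_ev)
  then show ?thesis
    using f assms eventually_nhds_x_imp_x[OF assms(1)] unfolding jet2_def by auto
qed

lemma jet2_const: "jet2 (\<lambda>_. c) t c 0 0"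
  unfolding jet2_def by (auto intro!: exI[of _ "\<lambda>_. 0"])

lemma jet2_add:
  assumes "jet2 f t a b c" "jet2 g t a' b' c'"
  shows "jet2 (\<lambda>s. f s + g s) t (a + a') (b + b') (c + c')"
proof -
  from assms obtain f' g' where
    f: "\<forall>\<^sub>F s in nhds t. (f has_real_derivative f' s) (at s)" "f' t = b" "(f' has_real_derivative c) (at t)"
    and g: "\<forall>\<^sub>F s in nhds t. (g has_real_derivative g' s) (at s)" "g' t = b'" "(g' has_real_derivative c') (at t)"
    unfolding jet2_def by blast
  have "\<forall>\<^sub>F s in nhds t. ((\<lambda>s. f s + g s) has_real_derivative f' s + g' s) (at s)"
    using f(1) g(1) by eventually_elim (rule DERIV_add)
  then show ?thesis using f g assms unfolding jet2_def
    by (auto intro!: exI[of _ "\<lambda>s. f' s + g' s"] DERIV_add)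
qed

lemma jet2_mult:
  assumes "jet2 f t a b c" "jet2 g t a' b' c'"
  shows "jet2 (\<lambda>s. f s * g s) t (a * a') (a * b' + b * a') (a * c' + 2 * b * b' + c * a')"
proof -
  from assms obtain f' g' where
    f: "\<forall>\<^sub>F s in nhds t. (f has_real_derivative f' s) (at s)" "f' t = b" "(f' has_real_derivative c) (at t)"
    and g: "\<forall>\<^sub>F s in nhds t. (g has_real_derivative g' s) (at s)" "g' t = b'" "(g' has_real_derivative c') (at t)"
    unfolding jet2_def by blast
  note d = jet2_DERIV[OF assms(1)] jet2_DERIV[OF assms(2)]
  have "\<forall>\<^sub>F s in nhds t. ((\<lambda>s. f s * g s) has_real_derivative f s * g' s + f' s * g s) (at s)"
    using f(1) g(1) by eventually_elim (auto intro!: derivative_eq_intros)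
  moreover have "((\<lambda>s. f s * g' s + f' s * g s) has_real_derivative a * c' + 2 * b * b' + c * a') (at t)"
    using f g d jet2_value[OF assms(1)] jet2_value[OF assms(2)]
    by (auto intro!: derivative_eq_intros simp: algebra_simps)
  ultimately show ?thesis using f g assms unfolding jet2_def
    by (auto intro!: exI[of _ "\<lambda>s. f s * g' s + f' s * g s"])
qed

lemma jet2_cmult: "jet2 f t a b c \<Longrightarrow> jet2 (\<lambda>s. k * f s) t (k * a) (k * b) (k * c)"
  using jet2_mult[OF jet2_const[of k t]] by simp

lemma jet2_sum:
  assumes "\<And>i. i \<in> J \<Longrightarrow> jet2 (f i) t (a i) (b i) (c i)"
  shows "jet2 (\<lambda>s. \<Sum>i\<in>J. f i s) t (\<Sum>i\<in>J. a i) (\<Sum>i\<in>J. b i) (\<Sum>i\<in>J. c i)"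
  using assms by (induction J rule: infinite_finite_induct) (auto intro: jet2_const jet2_add)

text \<open>Only existence of the derivatives is recorded: the chart coordinates are quotients whose
  jets get names but no formula.\<close>

lemma jet2_inverse:
  assumes "jet2 f t a b c" "a \<noteq> 0"
  shows "\<exists>b' c'. jet2 (\<lambda>s. inverse (f s)) t (inverse a) b' c'"
proof -
  from assms obtain f' where
    f: "\<forall>\<^sub>F s in nhds t. (f has_real_derivative f' s) (at s)" "f' t = b" "(f' has_real_derivative c) (at t)"
    unfolding jet2_def by blast
  note d = jet2_DERIV[OF assms(1)]
  have v: "f t \<noteq> 0" using assms jet2_value by metis
  have "isCont f t" using d by (rule DERIV_isCont)
  then have "\<forall>\<^sub>F s in nhds t. f s \<noteq> 0"
    using v by (simp add: tendsto_imp_eventually_ne eventually_nhds_conv_at isCont_def)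
  with f(1) have "\<forall>\<^sub>F s in nhds t. ((\<lambda>s. inverse (f s)) has_real_derivative
      - (inverse (f s) * f' s * inverse (f s))) (at s)"
    by eventually_elim (rule DERIV_inverse')
  moreover obtain c' where "((\<lambda>s. - (inverse (f s) * f' s * inverse (f s))) has_real_derivative c') (at t)"
    by (rule that) (rule derivative_eq_intros d v f refl)+
  ultimately have "jet2 (\<lambda>s. inverse (f s)) t (inverse a) (- (inverse a * b * inverse a)) c'"
    unfolding jet2_def using jet2_value[OF assms(1)] f(2)
    by (intro conjI exI[of _ "\<lambda>s. - (inverse (f s) * f' s * inverse (f s))"]) simp_all
  then show ?thesis by blast
qed

lemma jet2_power_one:
  assumes "jet2 f t 1 p q"
  shows "jet2 (\<lambda>s. f s ^ d) t 1 (real d * p) (real d * q + (real d * p)\<^sup>2 - real d * p\<^sup>2)"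
proof (induction d)
  case 0
  show ?case by (simp add: jet2_const)
next
  case (Suc d)
  show ?case using jet2_mult[OF assms Suc]
    by (simp add: algebra_simps power2_eq_square)
qed

text \<open>This is logarithmic differentiation at a point where every factor equals 1: with
  \<open>F\<close> the product, the second derivative of \<open>F\<close> is that of log
  \<open>F\<close> plus the square of its first derivative, and log \<open>F\<close> contributes
  \<open>d i * (q i - (p i)^2)\<close> for each factor.\<close>

lemma jet2_prod_power_one:
  fixes r :: nat
  assumes "\<And>i. i < r \<Longrightarrow> jet2 (f i) t 1 (p i) (q i)"
  shows "jet2 (\<lambda>s. \<Prod>i<r. f i s ^ d i) t 1 (\<Sum>i<r. real (d i) * p i)
    ((\<Sum>i<r. real (d i) * q i) + (\<Sum>i<r. real (d i) * p i)\<^sup>2 - (\<Sum>i<r. real (d i) * (p i)\<^sup>2))"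
  using assms
proof (induction r)
  case 0
  show ?case by (simp add: jet2_const)
next
  case (Suc r)
  have "jet2 (\<lambda>s. \<Prod>i<r. f i s ^ d i) t 1 (\<Sum>i<r. real (d i) * p i)
    ((\<Sum>i<r. real (d i) * q i) + (\<Sum>i<r. real (d i) * p i)\<^sup>2 - (\<Sum>i<r. real (d i) * (p i)\<^sup>2))"
    using Suc by simp
  from jet2_mult[OF this jet2_power_one[OF Suc.prems[of r], of "d r"]]
  show ?case by (simp add: algebra_simps power2_eq_square)
qed

lemma jet2_ip:
  assumes "\<And>A. A \<in> S \<Longrightarrow> jet2 (\<lambda>s. c s A) t (c0 A) (c1 A) (c2 A)"
  shows "jet2 (\<lambda>s. ip S w (c s) v) t (ip S w c0 v) (ip S w c1 v) (ip S w c2 v)"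
proof -
  have "jet2 (\<lambda>s. w A * v A * c s A) t (w A * v A * c0 A) (w A * v A * c1 A) (w A * v A * c2 A)"
    if "A \<in> S" for A by (rule jet2_cmult[OF assms[OF that]])
  from jet2_sum[of S, OF this] show ?thesis by (simp add: ip_def mult_ac)
qed

lemma jet2_dot:
  assumes "\<And>k. k \<le> n \<Longrightarrow> jet2 (\<lambda>s. x s k) t (x0 k) (x1 k) (x2 k)"
  shows "jet2 (\<lambda>s. dot n (x s) y) t (dot n x0 y) (dot n x1 y) (dot n x2 y)"
proof -
  have "jet2 (\<lambda>s. y k * x s k) t (y k * x0 k) (y k * x1 k) (y k * x2 k)"
    if "k \<in> {..n}" for k using that by (intro jet2_cmult assms) simp
  from jet2_sum[of "{..n}", OF this] show ?thesis by (simp add: dot_def mult_ac)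
qed

subsection \<open>Smooth functions\<close>

definition smooth_on :: "real set \<Rightarrow> (real \<Rightarrow> real) \<Rightarrow> bool" where
  "smooth_on I f \<longleftrightarrow> (\<forall>k. \<forall>t\<in>I. (deriv ^^ k) f differentiable (at t))"

lemma smooth_curve_iff: "smooth_curve I \<gamma> \<longleftrightarrow> (\<forall>A. smooth_on I (\<lambda>s. \<gamma> s A))"
  by (auto simp: smooth_curve_def smooth_on_def)

lemma smooth_on_deriv: "smooth_on I f \<Longrightarrow> smooth_on I (deriv f)"
  unfolding smooth_on_def by (metis funpow_Suc_right o_apply)

lemma smooth_on_DERIV:
  assumes "smooth_on I f" "t \<in> I"
  shows "(f has_real_derivative deriv f t) (at t)"
proof -
  have "(deriv ^^ 0) f differentiable (at t)" using assms unfolding smooth_on_def by blast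
  then show ?thesis by (simp add: DERIV_deriv_iff_real_differentiable)
qed

lemma funpow_deriv_cong:
  assumes "open I" "\<And>t. t \<in> I \<Longrightarrow> f t = g t" "t \<in> I"
  shows "(deriv ^^ k) f t = ((deriv ^^ k) g t :: real)"
  using assms(3)
proof (induction k arbitrary: t)
  case (Suc k)
  have "\<forall>\<^sub>F s in nhds t. (deriv ^^ k) f s = (deriv ^^ k) g s"
    using Suc assms(1) by (auto simp: eventually_nhds)
  then show ?case by (simp add: deriv_cong_ev)
qed (use assms in auto)

text \<open>A class of functions closed under differentiation on \<open>I\<close> contains only
  smooth functions. This gives closure properties without formulas for higher derivatives. Openness
  of \<open>I\<close> lets \<open>deriv f\<close> be replaced by \<open>g\<close> under further
  differentiation.\<close>

lemma smooth_on_coinduct: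
  assumes "open I" "P f"
    and step: "\<And>f. P f \<Longrightarrow> \<exists>g. P g \<and> (\<forall>t\<in>I. (f has_real_derivative g t) (at t))"
  shows "smooth_on I f"
  unfolding smooth_on_def
proof
  fix k
  show "\<forall>t\<in>I. (deriv ^^ k) f differentiable (at t)"
    using \<open>P f\<close>
  proof (induction k arbitrary: f)
    case 0
    then show ?case using step[OF 0] by (auto simp: real_differentiable_def)
  next
    case (Suc k)
    obtain g where g: "P g" "\<forall>t\<in>I. (f has_real_derivative g t) (at t)" using step[OF Suc.prems] by blast
    have e: "(deriv ^^ k) (deriv f) t = (deriv ^^ k) g t" if "t \<in> I" for t
      using funpow_deriv_cong[OF \<open>open I\<close> _ that, of "deriv f" g] g(2) DERIV_imp_deriv by blast
    show ?case
    proof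
      fix t assume t: "t \<in> I"
      have "\<forall>\<^sub>F s in nhds t. (deriv ^^ k) (deriv f) s = (deriv ^^ k) g s"
        using e t \<open>open I\<close> by (auto simp: eventually_nhds)
      moreover obtain D where "((deriv ^^ k) g has_real_derivative D) (at t)"
        using Suc.IH[OF g(1)] t by (metis real_differentiable_def)
      ultimately have "((deriv ^^ k) (deriv f) has_real_derivative D) (at t)"
        using DERIV_cong_ev[OF refl] by metis
      then show "(deriv ^^ Suc k) f differentiable (at t)"
        unfolding funpow_Suc_right by (auto simp: real_differentiable_def)
    qed
  qed
qed

text \<open>The algebra generated by the smooth functions: the sum and product rules keep
  derivatives inside it, so it is an invariant for \<open>smooth_on_coinduct\<close>.\<close>

inductive smooth_alg :: "real set \<Rightarrow> (real \<Rightarrow> real) \<Rightarrow> bool" for I where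
  "smooth_on I f \<Longrightarrow> smooth_alg I f"
| "smooth_alg I f \<Longrightarrow> smooth_alg I g \<Longrightarrow> smooth_alg I (\<lambda>s. f s + g s)"
| "smooth_alg I f \<Longrightarrow> smooth_alg I g \<Longrightarrow> smooth_alg I (\<lambda>s. f s * g s)"

lemma smooth_on_smooth_alg:
  assumes "open I" "smooth_alg I f"
  shows "smooth_on I f"
proof (rule smooth_on_coinduct[where P = "smooth_alg I", OF assms])
  fix f assume "smooth_alg I f"
  then show "\<exists>g. smooth_alg I g \<and> (\<forall>t\<in>I. (f has_real_derivative g t) (at t))"
  proof induction
    case (1 f)
    then show ?case using smooth_on_deriv smooth_on_DERIV smooth_alg.intros(1) by blast
  next
    case (2 f g)
    then obtain f' g' where "smooth_alg I f'" "\<forall>t\<in>I. (f has_real_derivative f' t) (at t)"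
      "smooth_alg I g'" "\<forall>t\<in>I. (g has_real_derivative g' t) (at t)" by blast
    then show ?case
      by (intro exI[of _ "\<lambda>s. f' s + g' s"]) (auto intro!: smooth_alg.intros(2) DERIV_add)
  next
    case (3 f g)
    then obtain f' g' where "smooth_alg I f'" "\<forall>t\<in>I. (f has_real_derivative f' t) (at t)"
      "smooth_alg I g'" "\<forall>t\<in>I. (g has_real_derivative g' t) (at t)" by blast
    with 3 show ?case
      by (intro exI[of _ "\<lambda>s. f s * g' s + f' s * g s"])
        (auto intro!: smooth_alg.intros(2,3) derivative_eq_intros)
  qed
qed

lemma smooth_on_add:
  "open I \<Longrightarrow> smooth_on I f \<Longrightarrow> smooth_on I g \<Longrightarrow> smooth_on I (\<lambda>s. f s + g s)"
  by (rule smooth_on_smooth_alg) (simp_all add: smooth_alg.intros)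

lemma smooth_on_mult:
  "open I \<Longrightarrow> smooth_on I f \<Longrightarrow> smooth_on I g \<Longrightarrow> smooth_on I (\<lambda>s. f s * g s)"
  by (rule smooth_on_smooth_alg) (simp_all add: smooth_alg.intros)

lemma smooth_on_const: "open I \<Longrightarrow> smooth_on I (\<lambda>_. c)"
proof (rule smooth_on_coinduct[where P = "\<lambda>f. \<exists>c. f = (\<lambda>_. c)"])
  fix f :: "real \<Rightarrow> real" assume "\<exists>c. f = (\<lambda>_. c)"
  then have "(f has_real_derivative 0) (at t)" for t by auto
  then show "\<exists>g. (\<exists>c. g = (\<lambda>_. c)) \<and> (\<forall>t\<in>I. (f has_real_derivative g t) (at t))" by blast
qed blast+

lemma smooth_on_prod:
  assumes "open I" "\<And>i. i \<in> J \<Longrightarrow> smooth_on I (f i)"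
  shows "smooth_on I (\<lambda>s. \<Prod>i\<in>J. f i s)"
  using assms by (induction J rule: infinite_finite_induct) (simp_all add: smooth_on_const smooth_on_mult)

lemma smooth_on_power:
  assumes "open I" "smooth_on I f"
  shows "smooth_on I (\<lambda>s. f s ^ k)"
  using assms by (induction k) (simp_all add: smooth_on_const smooth_on_mult)

text \<open>The linear span of \<open>cos\<close> and \<open>sin\<close> is closed under
  differentiation.\<close>

lemma smooth_on_cos_sin:
  assumes "open I"
  shows "smooth_on I cos" "smooth_on I sin"
proof -
  define P :: "(real \<Rightarrow> real) \<Rightarrow> bool" where "P f \<longleftrightarrow> (\<exists>a b. f = (\<lambda>s. a * cos s + b * sin s))" for f
  have step: "\<exists>g. P g \<and> (\<forall>t\<in>I. (f has_real_derivative g t) (at t))" if "P f" for f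
  proof -
    obtain a b where f: "f = (\<lambda>s. a * cos s + b * sin s)" using \<open>P f\<close> unfolding P_def by blast
    have "P (\<lambda>s. b * cos s + (- a) * sin s)" unfolding P_def by blast
    moreover have "(f has_real_derivative b * cos t + (- a) * sin t) (at t)" for t
      unfolding f by (auto intro!: derivative_eq_intros)
    ultimately show ?thesis by blast
  qed
  have "P (\<lambda>s. 1 * cos s + 0 * sin s)" "P (\<lambda>s. 0 * cos s + 1 * sin s)" unfolding P_def by blast+
  then have "P cos" "P sin" by simp_all
  then show "smooth_on I cos" "smooth_on I sin"
    using smooth_on_coinduct[where P = P, OF assms _ step] by blast+
qed

lemma smooth_on_cong:
  assumes "open I" "\<And>t. t \<in> I \<Longrightarrow> f t = g t" "smooth_on I f"
  shows "smooth_on I g"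
proof (rule smooth_on_coinduct[where P = "\<lambda>g. \<exists>f. smooth_on I f \<and> (\<forall>t\<in>I. f t = g t)", OF assms(1)])
  show "\<exists>f. smooth_on I f \<and> (\<forall>t\<in>I. f t = g t)" using assms by blast
next
  fix g assume "\<exists>f. smooth_on I f \<and> (\<forall>t\<in>I. f t = g t)"
  then obtain f where f: "smooth_on I f" "\<forall>t\<in>I. f t = g t" by blast
  have "(g has_real_derivative deriv f t) (at t)" if "t \<in> I" for t
  proof -
    have "\<forall>\<^sub>F s in nhds t. f s = g s"
      using f(2) that assms(1) by (auto simp: eventually_nhds)
    then show ?thesis using smooth_on_DERIV[OF f(1) that] DERIV_cong_ev[OF refl] by metis
  qed
  then show "\<exists>h. (\<exists>f. smooth_on I f \<and> (\<forall>t\<in>I. f t = h t)) \<and> (\<forall>t\<in>I. (g has_real_derivative h t) (at t))"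
    using smooth_on_deriv[OF f(1)] by blast
qed

lemma jet2_smooth_on:
  assumes "open I" "smooth_on I f" "t \<in> I"
  shows "jet2 f t (f t) (deriv f t) (deriv (deriv f) t)"
proof -
  have "\<forall>\<^sub>F s in nhds t. (f has_real_derivative deriv f s) (at s)"
    using assms smooth_on_DERIV by (auto simp: eventually_nhds)
  moreover have "(deriv f has_real_derivative deriv (deriv f) t) (at t)"
    using assms smooth_on_deriv smooth_on_DERIV by blast
  ultimately show ?thesis unfolding jet2_def by blast
qed

lemma jet2_smooth_curve:
  assumes "open I" "smooth_curve I \<gamma>" "t \<in> I"
  shows "jet2 (\<lambda>s. \<gamma> s A) t (\<gamma> t A) (vel \<gamma> t A) (acc \<gamma> t A)"
  using assms jet2_smooth_on unfolding smooth_curve_iff vel_def acc_def by blast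

subsection \<open>Curves in the Segre--Veronese manifold\<close>

lemma smooth_curve_ver:
  assumes "open I" "\<And>k. smooth_on I (\<lambda>s. q s k)"
  shows "smooth_curve I (\<lambda>s. ver n d (q s))"
  unfolding smooth_curve_iff
proof
  fix \<alpha>
  have "smooth_on I (\<lambda>s. multinom n d \<alpha> * (\<Prod>i\<le>n. q s i ^ \<alpha> i))"
    using assms by (intro smooth_on_mult smooth_on_const smooth_on_prod smooth_on_power)
  then show "smooth_on I (\<lambda>s. ver n d (q s) \<alpha>)"
    using smooth_on_const[OF \<open>open I\<close>, of 0] by (cases "\<alpha> \<in> Mon n d") (simp_all add: ver_def)
qed

lemma smooth_curve_tensor:
  assumes "open I" "\<And>i. i < r \<Longrightarrow> smooth_curve I (f i)"
  shows "smooth_curve I (\<lambda>s. tensor r n d (\<lambda>i. f i s))"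
  unfolding smooth_curve_iff
proof
  fix A
  have "smooth_on I (\<lambda>s. \<Prod>i<r. f i s (A ! i))"
    using assms by (intro smooth_on_prod) (auto simp: smooth_curve_iff)
  then show "smooth_on I (\<lambda>s. tensor r n d (\<lambda>i. f i s) A)"
    using smooth_on_const[OF \<open>open I\<close>, of 0] by (cases "A \<in> Idx r n d") (simp_all add: tensor_def)
qed

lemma smooth_curve_cmult:
  assumes "open I" "smooth_curve I f"
  shows "smooth_curve I (\<lambda>s A. c * f s A)"
  using assms unfolding smooth_curve_iff by (auto intro!: smooth_on_mult smooth_on_const)

lemma jet2_ip_smooth_curve:
  assumes "open I" "smooth_curve I c" "t \<in> I"
  shows "jet2 (\<lambda>s. ip S w (c s) v) t (ip S w (c t) v) (ip S w (vel c t) v) (ip S w (acc c t) v)"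
  using jet2_smooth_curve[OF assms] by (rule jet2_ip)

lemma DERIV_ip_smooth_curve:
  assumes "open I" "smooth_curve I c" "t \<in> I"
  shows "((\<lambda>s. ip S w v (c s)) has_real_derivative ip S w v (vel c t)) (at t)"
  using jet2_DERIV[OF jet2_ip_smooth_curve[OF assms]] by (simp add: ip_commute)

text \<open>Polarization: differentiate the reproducing identity \<open>\<langle>a^d, e^d\<rangle> = (a \<cdot> e)^d\<close>
  in the \<open>k\<close>-th entry of \<open>e\<close>.\<close>

lemma polar_exists:
  assumes "d \<ge> 1" "k \<le> n"
  shows "\<exists>P. \<forall>a. ip (Mon n d) (bw_w n d) (ver n d a) P = a k * dot n a e ^ (d - 1)"
proof -
  \<comment> \<open>\<open>sin s\<close> serves as a smooth parameter with value 0 and derivative 1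
    at 0, so the velocity at 0 is the partial derivative in the \<open>k\<close>-th entry.\<close>
  define q where "q s i = e i + sin s * (if i = k then 1 else 0)" for s i
  define D where "D = vel (\<lambda>s. ver n d (q s)) 0"
  have sm: "smooth_curve UNIV (\<lambda>s. ver n d (q s))"
    unfolding q_def
    by (intro smooth_curve_ver smooth_on_add smooth_on_mult smooth_on_const smooth_on_cos_sin open_UNIV)
  have "ip (Mon n d) (bw_w n d) (ver n d a) D = real d * (a k * dot n a e ^ (d - 1))" for a
  proof -
    have "dot n a (q s) = dot n a e + sin s * a k" for s
    proof -
      have "a i * q s i = a i * e i + (if i = k then sin s * a k else 0)" for i
        by (simp add: q_def algebra_simps)
      then show ?thesis using \<open>k \<le> n\<close> by (simp add: dot_def sum.distrib sum.delta)
    qed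
    then have "((\<lambda>s. (dot n a e + sin s * a k) ^ d) has_real_derivative
        ip (Mon n d) (bw_w n d) (ver n d a) D) (at 0)"
      using DERIV_ip_smooth_curve[OF open_UNIV sm UNIV_I, of "Mon n d" "bw_w n d" "ver n d a" 0]
      unfolding ip_ver D_def by simp
    moreover have "((\<lambda>s. (dot n a e + sin s * a k) ^ d) has_real_derivative
        real d * (a k * dot n a e ^ (d - 1))) (at 0)"
      by (auto intro!: derivative_eq_intros)
    ultimately show ?thesis by (rule DERIV_unique)
  qed
  \<comment> \<open>Dividing by \<open>d\<close> removes the factor produced by the power
    rule.\<close>
  then have "\<forall>a. ip (Mon n d) (bw_w n d) (ver n d a) (\<lambda>\<alpha>. (1 / real d) * D \<alpha>) = a k * dot n a e ^ (d - 1)"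
    using \<open>d \<ge> 1\<close> unfolding ip_scale_right by simp
  then show ?thesis by blast
qed

section \<open>Normal projection and unit representatives of points\<close>

text \<open>The definite description in \<open>proj\<close> requires uniqueness: the difference of
  two candidates is normal and orthogonal to itself, so positive weights make it vanish on
  \<open>S\<close>, and \<open>coord_space\<close> makes it vanish outside.\<close>

lemma proj_eqI:
  assumes "finite S" "\<And>A. A \<in> S \<Longrightarrow> w A > 0"
    and p: "p \<in> normal_space S w M G"
    and o: "\<And>u. u \<in> normal_space S w M G \<Longrightarrow> ip S w (\<lambda>A. v A - p A) u = 0"
  shows "proj S w (normal_space S w M G) v = p"
  unfolding proj_def
proof (rule the_equality)
  show "p \<in> normal_space S w M G \<and> (\<forall>u\<in>normal_space S w M G. ip S w (\<lambda>A. v A - p A) u = 0)"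
    using p o by blast
next
  fix p' assume p': "p' \<in> normal_space S w M G \<and> (\<forall>u\<in>normal_space S w M G. ip S w (\<lambda>A. v A - p' A) u = 0)"
  define u where "u = (\<lambda>A. p A - p' A)"
  have u: "u \<in> normal_space S w M G"
    using p p' by (auto simp: normal_space_def coord_space_def u_def ip_diff_left)
  have "ip S w (\<lambda>A. v A - p' A) u - ip S w (\<lambda>A. v A - p A) u = 0" using p' o[OF u] u by simp
  then have "ip S w u u = 0" unfolding ip_diff_left[symmetric] by (simp add: u_def)
  moreover have "w A * u A * u A \<ge> 0" if "A \<in> S" for A
    using assms(2)[OF that] by (simp add: mult.assoc)
  ultimately have "\<forall>A\<in>S. w A * u A * u A = 0"
    using \<open>finite S\<close> unfolding ip_def by (simp add: sum_nonneg_eq_0_iff)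
  then have "u A = 0" if "A \<in> S" for A using that assms(2)[OF that] by auto
  moreover have "u A = 0" if "A \<notin> S" for A using that u by (simp add: normal_space_def coord_space_def)
  ultimately show "p' = p" unfolding u_def fun_eq_iff by (metis eq_iff_diff_eq_0)
qed

lemma tw_pos: "tw r n d A > 0"
  by (simp add: tw_def bw_w_def multinom_pos prod_pos)

lemma square_sign: "\<epsilon> = 1 \<or> \<epsilon> = - 1 \<Longrightarrow> \<epsilon> * \<epsilon> = (1 :: real)"
  by auto

text \<open>The squared norm of a signed power is the \<open>d\<close>-th power of
  \<open>dot n a a\<close>, a nonnegative number, so norm 1 with positive degree forces a unit
  vector.\<close>

lemma Vset_unit:
  assumes "F \<in> Vset n d" "d \<ge> 1"
  obtains s a where "s = 1 \<or> s = -1" "dot n a a = 1" "F = (\<lambda>\<alpha>. s * ver n d a \<alpha>)"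
proof -
  obtain a s where s: "s = 1 \<or> s = -1" "F = (\<lambda>\<alpha>. s * ver n d a \<alpha>)"
    and N: "nrm (Mon n d) (bw_w n d) F = 1"
    using assms unfolding Vset_def by blast
  have "s * (s * dot n a a ^ d) = 1"
    using N unfolding nrm_def s(2) ip_scale_left ip_scale_right ip_ver by simp
  then have "dot n a a ^ d = 1" using s(1) by auto
  moreover have "dot n a a \<ge> 0" by (simp add: dot_def sum_nonneg)
  ultimately have "dot n a a = 1" using \<open>d \<ge> 1\<close> power_eq_iff_eq_base[of d "dot n a a" 1] by simp
  then show ?thesis using that s by blast
qed

lemma Vset_unitI:
  assumes "s = 1 \<or> s = -1" "dot n a a = 1"
  shows "(\<lambda>\<alpha>. s * ver n d a \<alpha>) \<in> Vset n d"
  unfolding Vset_def using assms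
  by (auto simp: nrm_def ip_scale_left ip_scale_right ip_ver intro!: exI[of _ a])

text \<open>Interpreted twice: with the parameters of the theorem, and with a single factor to study
  Veronese geodesics.\<close>

locale segre_veronese =
  fixes r :: nat and n d :: "nat \<Rightarrow> nat"
  assumes d_ge_1: "i < r \<Longrightarrow> d i \<ge> 1"
begin

abbreviation "S \<equiv> Idx r n d"
abbreviation "w \<equiv> tw r n d"
abbreviation "X \<equiv> Xset r n d"
abbreviation "ten a \<equiv> tensor r n d (\<lambda>i. ver (n i) (d i) (a i))"

lemma Xset_unit:
  assumes "F \<in> X"
  obtains \<eta> a where "\<eta> = 1 \<or> \<eta> = -1" "\<And>i. i < r \<Longrightarrow> dot (n i) (a i) (a i) = 1" "F = (\<lambda>A. \<eta> * ten a A)"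
proof -
  obtain fs where fs: "F = tensor r n d fs" "\<forall>i<r. fs i \<in> Vset (n i) (d i)"
    using assms unfolding Xset_def by blast
  have "\<forall>i. \<exists>s a. i < r \<longrightarrow> (s = 1 \<or> s = -1) \<and> dot (n i) a a = 1 \<and> fs i = (\<lambda>\<alpha>. s * ver (n i) (d i) a \<alpha>)"
    using fs(2) d_ge_1 Vset_unit by metis
  then obtain s a where sa: "\<And>i. i < r \<Longrightarrow> s i = 1 \<or> s i = -1" "\<And>i. i < r \<Longrightarrow> dot (n i) (a i) (a i) = 1"
    "\<And>i. i < r \<Longrightarrow> fs i = (\<lambda>\<alpha>. s i * ver (n i) (d i) (a i) \<alpha>)" by metis
  have "F = (\<lambda>A. (\<Prod>i<r. s i) * ten a A)"
    unfolding fs(1) tensor_scale[symmetric] using sa(3) by (rule tensor_cong)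
  moreover have "\<bar>s i\<bar> = 1" if "i < r" for i using sa(1)[OF that] by auto
  then have "\<bar>\<Prod>i<r. s i\<bar> = 1"
    unfolding abs_prod by (intro prod.neutral) simp
  then have "(\<Prod>i<r. s i) = 1 \<or> (\<Prod>i<r. s i) = -1" by linarith
  ultimately show ?thesis using that sa(2) by blast
qed

lemma Xset_unitI:
  assumes "0 < r" "\<eta> = 1 \<or> \<eta> = -1" "\<And>i. i < r \<Longrightarrow> dot (n i) (a i) (a i) = 1"
  shows "(\<lambda>A. \<eta> * ten a A) \<in> X"
proof -
  \<comment> \<open>The global sign is absorbed into factor 0, which exists because \<open>r\<close>
    is positive.\<close>
  define s where "s i = (if i = 0 then \<eta> else 1)" for i :: nat
  have "(\<Prod>i<r. s i) = \<eta>" using assms(1) by (simp add: s_def prod.delta)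
  then have "(\<lambda>A. \<eta> * ten a A) = tensor r n d (\<lambda>i \<alpha>. s i * ver (n i) (d i) (a i) \<alpha>)"
    unfolding tensor_scale by simp
  moreover have "(\<lambda>\<alpha>. s i * ver (n i) (d i) (a i) \<alpha>) \<in> Vset (n i) (d i)" if "i < r" for i
    using assms that by (intro Vset_unitI) (auto simp: s_def)
  ultimately show ?thesis unfolding Xset_def by blast
qed

lemma Xset_norm:
  assumes "F \<in> X"
  shows "ip S w F F = 1"
proof -
  obtain \<eta> a where "\<eta> = 1 \<or> \<eta> = -1" "\<And>i. i < r \<Longrightarrow> dot (n i) (a i) (a i) = 1" "F = (\<lambda>A. \<eta> * ten a A)"
    by (rule Xset_unit[OF assms]) blast
  then show ?thesis by (auto simp: ip_scale_left ip_scale_right ip_tensor_ver)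
qed

text \<open>Differentiate the constant \<open>ip S w (c s) (c s) = 1\<close> once and twice.\<close>

lemma ip_vel_acc_Xset:
  assumes "open I" "smooth_curve I c" "\<forall>t\<in>I. c t \<in> X" "t \<in> I"
  shows "ip S w (vel c t) (c t) = 0"
    and "ip S w (acc c t) (c t) = - ip S w (vel c t) (vel c t)"
proof -
  let ?a = "\<lambda>A. c t A" and ?b = "\<lambda>A. vel c t A" and ?c = "\<lambda>A. acc c t A"
  have J: "jet2 (\<lambda>s. w A * (c s A * c s A)) t (w A * (?a A * ?a A)) (w A * (?a A * ?b A + ?b A * ?a A))
     (w A * (?a A * ?c A + 2 * ?b A * ?b A + ?c A * ?a A))" for A
    by (intro jet2_cmult jet2_mult jet2_smooth_curve[OF assms(1,2,4)])
  have "jet2 (\<lambda>s. ip S w (c s) (c s)) t (ip S w (c t) (c t)) (2 * ip S w (vel c t) (c t))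
     (2 * ip S w (acc c t) (c t) + 2 * ip S w (vel c t) (vel c t))"
    using jet2_sum[of S, OF J]
    by (simp add: ip_def sum_distrib_left sum.distrib algebra_simps mult_2_right flip: sum.distrib)
  moreover have "\<forall>\<^sub>F s in nhds t. 1 = ip S w (c s) (c s)"
    unfolding eventually_nhds using assms Xset_norm by metis
  then have "jet2 (\<lambda>s. ip S w (c s) (c s)) t 1 0 0"
    using jet2_const by (rule jet2_cong)
  note jets = jet2_unique[OF calculation this]
  have "2 * ip S w (vel c t) (c t) = 0"
     "2 * ip S w (acc c t) (c t) + 2 * ip S w (vel c t) (vel c t) = 0"
    by (rule jets)+
  then show "ip S w (vel c t) (c t) = 0"
    "ip S w (acc c t) (c t) = - ip S w (vel c t) (vel c t)" by simp_all
qed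

lemma tangent_space_orth:
  assumes "u \<in> tangent_space X G"
  shows "ip S w G u = 0"
proof -
  obtain c e where c: "u = vel c 0" "0 < e" "smooth_curve (ball 0 e) c" "\<forall>s\<in>ball 0 e. c s \<in> X" "c 0 = G"
    using assms unfolding tangent_space_def by blast
  show ?thesis using ip_vel_acc_Xset(1)[OF open_ball c(3,4), of 0] c by (simp add: ip_commute)
qed

text \<open>An affine chart of \<open>X\<close> around \<open>\<epsilon> e\<^sub>1^d\<^sub>1 \<otimes> \<dots> \<otimes> e\<^sub>r^d\<^sub>r\<close>: the linear forms are
  normalized by \<open>x\<^sub>i \<cdot> e\<^sub>i = 1\<close>, so that the chart depends rationally on the point.\<close>

definition chart where
  "chart \<epsilon> e c t h x h2 v z \<longleftrightarrow> 
    (\<forall>\<^sub>F s in nhds t. c s = (\<lambda>A. \<epsilon> * h s * ten (\<lambda>i. x i s) A)) \<and> jet2 h t 1 0 h2 \<and>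
    (\<forall>i<r. (\<forall>k\<le>n i. jet2 (\<lambda>s. x i s k) t (e i k) (v i k) (z i k)) \<and>
           (\<forall>\<^sub>F s in nhds t. dot (n i) (x i s) (e i) = 1))"

lemma chart_jet_dot:
  assumes "chart \<epsilon> e c t h x h2 v z" "i < r"
  shows "jet2 (\<lambda>s. dot (n i) (x i s) y) t (dot (n i) (e i) y) (dot (n i) (v i) y) (dot (n i) (z i) y)"
  using assms unfolding chart_def by (intro jet2_dot) blast

text \<open>The normalization keeps \<open>dot (n i) (x i s) (e i)\<close> equal to 1, so its jet is
  \<open>1, 0, 0\<close>.\<close>

lemma chart_orth:
  assumes "chart \<epsilon> e c t h x h2 v z" "i < r"
  shows "dot (n i) (e i) (e i) = 1" "dot (n i) (v i) (e i) = 0" "dot (n i) (z i) (e i) = 0"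
proof -
  have "\<forall>\<^sub>F s in nhds t. 1 = dot (n i) (x i s) (e i)"
    using assms unfolding chart_def by (auto elim: eventually_mono)
  then have "jet2 (\<lambda>s. dot (n i) (x i s) (e i)) t 1 0 0"
    using jet2_const by (rule jet2_cong)
  from jet2_unique[OF chart_jet_dot[OF assms] this]
  show "dot (n i) (e i) (e i) = 1" "dot (n i) (v i) (e i) = 0" "dot (n i) (z i) (e i) = 0" by blast+
qed

lemma chart_base:
  assumes "chart \<epsilon> e c t h x h2 v z"
  shows "c t = (\<lambda>A. \<epsilon> * ten e A)"
proof -
  have "c t = (\<lambda>A. \<epsilon> * h t * ten (\<lambda>i. x i t) A)" "h t = 1"
    using assms eventually_nhds_x_imp_x[of _ t] jet2_value unfolding chart_def by blast+
  moreover have "ten (\<lambda>i. x i t) = ten e"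
    using assms unfolding chart_def by (intro tensor_cong ver_cong) (blast dest: jet2_value)
  ultimately show ?thesis by simp
qed

text \<open>The inner product factors as \<open>h\<close> times powers of
  \<open>dot (n i) (x i s) (y i)\<close>. The condition on \<open>y\<close> makes every base equal
  to 1 at \<open>t\<close>, so \<open>jet2_prod_power_one\<close> applies; the vanishing first
  derivative of \<open>h\<close> removes the mixed term.\<close>

lemma chart_jet_ip:
  assumes "chart \<epsilon> e c t h x h2 v z" "\<epsilon> * \<epsilon> = 1" "\<And>i. i < r \<Longrightarrow> dot (n i) (e i) (y i) = 1"
  shows "jet2 (\<lambda>s. ip S w (c s) (\<lambda>A. \<epsilon> * k * ten y A)) t k (k * (\<Sum>i<r. real (d i) * dot (n i) (v i) (y i)))
    (k * (h2 + (\<Sum>i<r. real (d i) * dot (n i) (z i) (y i)) + (\<Sum>i<r. real (d i) * dot (n i) (v i) (y i))\<^sup>2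
      - (\<Sum>i<r. real (d i) * (dot (n i) (v i) (y i))\<^sup>2)))"
proof -
  have hj: "jet2 h t 1 0 h2" using assms(1) unfolding chart_def by blast
  have "jet2 (\<lambda>s. dot (n i) (x i s) (y i)) t 1 (dot (n i) (v i) (y i)) (dot (n i) (z i) (y i))"
    if "i < r" for i using chart_jet_dot[OF assms(1) that] assms(3)[OF that] by metis
  from jet2_cmult[OF jet2_mult[OF hj jet2_prod_power_one[where d = d, OF this]], where k = k]
  have "jet2 (\<lambda>s. k * (h s * (\<Prod>i<r. dot (n i) (x i s) (y i) ^ d i))) t k (k * (\<Sum>i<r. real (d i) * dot (n i) (v i) (y i)))
    (k * (h2 + (\<Sum>i<r. real (d i) * dot (n i) (z i) (y i)) + (\<Sum>i<r. real (d i) * dot (n i) (v i) (y i))\<^sup>2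
      - (\<Sum>i<r. real (d i) * (dot (n i) (v i) (y i))\<^sup>2)))"
    by (simp add: algebra_simps)
  moreover have "\<forall>\<^sub>F s in nhds t. k * (h s * (\<Prod>i<r. dot (n i) (x i s) (y i) ^ d i)) = ip S w (c s) (\<lambda>A. \<epsilon> * k * ten y A)"
    using assms(1)[unfolded chart_def, THEN conjunct1]
  proof eventually_elim
    case (elim s)
    show ?case unfolding elim ip_scale_left ip_scale_right ip_tensor_ver using assms(2) by (simp add: mult_ac)
  qed
  ultimately show ?thesis by (rule jet2_cong[rotated])
qed

text \<open>The jet of \<open>ip S w (c s)\<close> against a fixed vector is read once from the
  derivatives of \<open>c\<close> and once from the chart.\<close>

lemma chart_ip_vel_acc:
  assumes "open I" "smooth_curve I c" "t \<in> I"
    and "chart \<epsilon> e c t h x h2 v z" "\<epsilon> * \<epsilon> = 1" "\<And>i. i < r \<Longrightarrow> dot (n i) (e i) (y i) = 1"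
  shows "ip S w (vel c t) (\<lambda>A. \<epsilon> * k * ten y A) = k * (\<Sum>i<r. real (d i) * dot (n i) (v i) (y i))"
    and "ip S w (acc c t) (\<lambda>A. \<epsilon> * k * ten y A) =
      k * (h2 + (\<Sum>i<r. real (d i) * dot (n i) (z i) (y i)) + (\<Sum>i<r. real (d i) * dot (n i) (v i) (y i))\<^sup>2
      - (\<Sum>i<r. real (d i) * (dot (n i) (v i) (y i))\<^sup>2))"
  using jet2_unique[OF jet2_ip_smooth_curve[OF assms(1-3)] chart_jet_ip[OF assms(4-6)]] by blast+

text \<open>Pairing \<open>c s\<close> with \<open>Q i k\<close>, the polarizing vector in slot
  \<open>i\<close> and powers of \<open>e j\<close> elsewhere, gives \<open>h s\<close> times the
  \<open>k\<close>-th coordinate of the normalized \<open>i\<close>-th form. Coordinates are thus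
  quotients of linear functionals of the curve and inherit its differentiability, although the
  representatives \<open>a\<close> are chosen separately at each point.\<close>

lemma chart_exists:
  assumes "open I" "smooth_curve I c" "t \<in> I" "\<forall>t\<in>I. c t \<in> X"
    and \<epsilon>: "\<epsilon> = 1 \<or> \<epsilon> = -1" and e: "\<And>i. i < r \<Longrightarrow> dot (n i) (e i) (e i) = 1" and ct: "c t = (\<lambda>A. \<epsilon> * ten e A)"
  shows "\<exists>h x h2 v z. chart \<epsilon> e c t h x h2 v z"
proof -
  have "\<forall>i k. \<exists>P. i < r \<and> k \<le> n i \<longrightarrow> (\<forall>a. ip (Mon (n i) (d i)) (bw_w (n i) (d i)) (ver (n i) (d i) a) P =
      a k * dot (n i) a (e i) ^ (d i - 1))"
    using polar_exists d_ge_1 by blast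
  then obtain P where P: "\<And>i k a. i < r \<Longrightarrow> k \<le> n i \<Longrightarrow> ip (Mon (n i) (d i)) (bw_w (n i) (d i)) (ver (n i) (d i) a) (P i k) =
      a k * dot (n i) a (e i) ^ (d i - 1)" by metis
  define Q where "Q i k = (\<lambda>A. \<epsilon> * tensor r n d (\<lambda>j. if j = i then P i k else ver (n j) (d j) (e j)) A)" for i k
  define h where "h s = ip S w (c s) (c t)" for s
  define x where "x i s k = ip S w (c s) (Q i k) * inverse (h s)" for i s k
  have ee: "\<epsilon> * \<epsilon> = 1" using \<epsilon> by (rule square_sign)
  have h_val: "h s = \<eta> * \<epsilon> * (\<Prod>j<r. dot (n j) (a j) (e j) ^ d j)" if "c s = (\<lambda>A. \<eta> * ten a A)" for \<eta> a s
    unfolding h_def that ct ip_scale_left ip_scale_right ip_tensor_ver by simp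
  \<comment> \<open>The value does not depend on the sign or scale of the chosen representative: it
    is the multiple of \<open>a i\<close> whose product with \<open>e i\<close> is 1.\<close>
  have x_val: "x i s k = inverse (dot (n i) (a i) (e i)) * a i k"
    if cs: "c s = (\<lambda>A. \<eta> * ten a A)" and h0: "h s \<noteq> 0" and i: "i < r" "k \<le> n i" for \<eta> a i s k
  proof -
    have nz: "dot (n i) (a i) (e i) \<noteq> 0"
      using h0 i d_ge_1[OF i(1)] unfolding h_val[OF cs] by auto
    have "ip S w (c s) (Q i k) = \<eta> * \<epsilon> * (\<Prod>j<r. ip (Mon (n j) (d j)) (bw_w (n j) (d j))
        (ver (n j) (d j) (a j)) (if j = i then P i k else ver (n j) (d j) (e j)))"
      unfolding cs Q_def ip_scale_left ip_scale_right ip_tensor by simp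
    also have "(\<Prod>j<r. ip (Mon (n j) (d j)) (bw_w (n j) (d j))
        (ver (n j) (d j) (a j)) (if j = i then P i k else ver (n j) (d j) (e j))) =
        (\<Prod>j<r. dot (n j) (a j) (e j) ^ d j * (if j = i then inverse (dot (n i) (a i) (e i)) * a i k else 1))"
    proof (rule prod.cong)
      fix j assume "j \<in> {..<r}"
      \<comment> \<open>Slot \<open>i\<close> contributes only the power \<open>d i - 1\<close>;
        writing it as the full power over one factor lets \<open>h s\<close> be pulled out.\<close>
      have "dot (n i) (a i) (e i) ^ d i = dot (n i) (a i) (e i) * dot (n i) (a i) (e i) ^ (d i - 1)"
        using d_ge_1[OF i(1)] by (simp add: power_eq_if)
      then show "ip (Mon (n j) (d j)) (bw_w (n j) (d j))
        (ver (n j) (d j) (a j)) (if j = i then P i k else ver (n j) (d j) (e j)) =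
        dot (n j) (a j) (e j) ^ d j * (if j = i then inverse (dot (n i) (a i) (e i)) * a i k else 1)"
        using P[OF i] nz by (simp add: ip_ver)
    qed simp
    also have "\<dots> = (\<Prod>j<r. dot (n j) (a j) (e j) ^ d j) * (inverse (dot (n i) (a i) (e i)) * a i k)"
      unfolding prod.distrib using i by (simp add: prod.delta)
    finally have "ip S w (c s) (Q i k) = h s * (inverse (dot (n i) (a i) (e i)) * a i k)"
      unfolding h_val[OF cs] by simp
    then show ?thesis using h0 by (simp add: x_def)
  qed
  have ctX: "c t \<in> X" using assms by blast
  \<comment> \<open>The first derivative is 0 because the velocity is orthogonal to the point
    \<open>c t\<close>.\<close>
  have jh: "jet2 h t 1 0 (ip S w (acc c t) (c t))"
    using jet2_ip_smooth_curve[OF assms(1-3), where S = S and w = w and v = "c t"] ip_vel_acc_Xset(1)[OF assms(1,2,4,3)]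
      Xset_norm[OF ctX] unfolding h_def by simp
  have ht: "h t = 1" using jh jet2_value by blast
  have xt: "x i t k = e i k" if "i < r" "k \<le> n i" for i k
    using x_val[OF ct _ that] ht e[OF that(1)] by simp
  have "\<exists>b c'. jet2 (\<lambda>s. x i s k) t (e i k) b c'" if ik: "i < r" "k \<le> n i" for i k
  proof -
    obtain b' c' where "jet2 (\<lambda>s. inverse (h s)) t (inverse 1) b' c'"
      using jet2_inverse[OF jh] by auto
    from jet2_mult[OF jet2_ip_smooth_curve[OF assms(1-3), where S = S and w = w and v = "Q i k"] this]
    obtain a'' b'' c'' where "jet2 (\<lambda>s. x i s k) t a'' b'' c''" unfolding x_def by blast
    moreover from jet2_value[OF this] xt[OF ik] have "a'' = e i k" by simp
    ultimately show ?thesis by blast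
  qed
  then have "\<forall>i k. \<exists>b c'. i < r \<longrightarrow> k \<le> n i \<longrightarrow> jet2 (\<lambda>s. x i s k) t (e i k) b c'" by blast
  then obtain v z where vz: "\<And>i k. i < r \<Longrightarrow> k \<le> n i \<Longrightarrow> jet2 (\<lambda>s. x i s k) t (e i k) (v i k) (z i k)"
    by metis
  \<comment> \<open>Since \<open>h t = 1\<close>, continuity keeps \<open>h\<close> nonzero near
    \<open>t\<close>, where the quotients are meaningful.\<close>
  have "isCont h t" using jet2_DERIV[OF jh] by (rule DERIV_isCont)
  then have "\<forall>\<^sub>F s in nhds t. h s \<noteq> 0"
    using ht by (simp add: tendsto_imp_eventually_ne eventually_nhds_conv_at isCont_def)
  moreover have "\<forall>\<^sub>F s in nhds t. s \<in> I" using assms by (auto simp: eventually_nhds)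
  ultimately have ev: "\<forall>\<^sub>F s in nhds t. c s = (\<lambda>A. \<epsilon> * h s * ten (\<lambda>i. x i s) A) \<and>
     (\<forall>i<r. dot (n i) (x i s) (e i) = 1)"
  proof eventually_elim
    case (elim s)
    then have csX: "c s \<in> X" using assms(4) by blast
    obtain \<eta> a where a: "\<eta> = 1 \<or> \<eta> = -1" "\<And>i. i < r \<Longrightarrow> dot (n i) (a i) (a i) = 1" "c s = (\<lambda>A. \<eta> * ten a A)"
      by (rule Xset_unit[OF csX]) blast
    let ?l = "\<lambda>i. inverse (dot (n i) (a i) (e i))"
    have nz: "dot (n i) (a i) (e i) \<noteq> 0" if "i < r" for i
      using elim that d_ge_1[OF that] unfolding h_val[OF a(3)] by auto
    have "ten (\<lambda>i. x i s) = tensor r n d (\<lambda>i \<alpha>. ?l i ^ d i * ver (n i) (d i) (a i) \<alpha>)"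
      unfolding ver_scale[symmetric] using x_val[OF a(3)] elim
      by (intro tensor_cong ver_cong) auto
    also have "\<dots> = (\<lambda>A. (\<Prod>i<r. ?l i ^ d i) * ten a A)"
      by (rule tensor_scale)
    finally have T: "ten (\<lambda>i. x i s) = (\<lambda>A. (\<Prod>i<r. ?l i ^ d i) * ten a A)" .
    have "(\<Prod>j<r. dot (n j) (a j) (e j) ^ d j) * (\<Prod>i<r. ?l i ^ d i) = 1"
      unfolding prod.distrib[symmetric] using nz by (intro prod.neutral) (auto simp: power_mult_distrib[symmetric])
    then have "\<epsilon> * h s * (\<Prod>i<r. ?l i ^ d i) = (\<epsilon> * \<epsilon>) * \<eta>"
      unfolding h_val[OF a(3)] by (simp add: mult_ac)
    then have "c s = (\<lambda>A. \<epsilon> * h s * ten (\<lambda>i. x i s) A)"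
      unfolding T a(3) ee by (simp add: mult.assoc[symmetric])
    moreover have "dot (n i) (x i s) (e i) = 1" if "i < r" for i
    proof -
      have "dot (n i) (x i s) (e i) = ?l i * dot (n i) (a i) (e i)"
        unfolding dot_def sum_distrib_left using x_val[OF a(3)] elim that
        by (intro sum.cong) (auto simp: dot_def)
      then show ?thesis using nz[OF that] by simp
    qed
    ultimately show ?case by blast
  qed
  have "chart \<epsilon> e c t h x (ip S w (acc c t) (c t)) v z"
    unfolding chart_def
  proof (intro conjI allI impI)
    show "\<forall>\<^sub>F s in nhds t. c s = (\<lambda>A. \<epsilon> * h s * ten (\<lambda>i. x i s) A)"
      using ev by eventually_elim blast
    show "\<forall>\<^sub>F s in nhds t. dot (n i) (x i s) (e i) = 1" if "i < r" for i
      using ev by eventually_elim (use that in blast)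
  qed (use jh vz in auto)
  then show ?thesis by blast
qed

text \<open>Both curves are charted at the same base point. The vectors \<open>vel c t\<close> and
  \<open>acc c t\<close> are paired with the moving point \<open>b s\<close>, and expanding in
  \<open>s\<close> exhibits the inner products with the velocity and acceleration of
  \<open>b\<close> as Taylor coefficients.\<close>

lemma chart_jets_vel_acc:
  assumes c: "open I" "smooth_curve I c" "t \<in> I" "chart \<epsilon> e c t h x h2 v z"
    and \<epsilon>: "\<epsilon> * \<epsilon> = 1"
    and b: "chart \<epsilon> e b \<tau> h' x' h2' v' z'"
  shows "\<exists>D. jet2 (\<lambda>s. ip S w (vel c t) (b s)) \<tau> 0 (\<Sum>i<r. real (d i) * dot (n i) (v i) (v' i)) D"
    and "jet2 (\<lambda>s. ip S w (acc c t) (b s)) \<tau> h2 (\<Sum>i<r. real (d i) * dot (n i) (z i) (v' i))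
      (h2' * h2 + (\<Sum>i<r. real (d i) * dot (n i) (z i) (z' i)) + 2 * (\<Sum>i<r. real (d i) * dot (n i) (v i) (v' i))\<^sup>2
      - 2 * (\<Sum>i<r. real (d i) * (dot (n i) (v i) (v' i))\<^sup>2))"
proof -
  let ?vs = "\<lambda>s. \<Sum>i<r. real (d i) * dot (n i) (v i) (x' i s)"
  let ?zs = "\<lambda>s. \<Sum>i<r. real (d i) * dot (n i) (z i) (x' i s)"
  let ?qs = "\<lambda>s. \<Sum>i<r. real (d i) * (dot (n i) (v i) (x' i s))\<^sup>2"
  have hj: "jet2 h' \<tau> 1 0 h2'" using b unfolding chart_def by blast
  have "\<forall>\<^sub>F s in nhds \<tau>. \<forall>i\<in>{..<r}. dot (n i) (x' i s) (e i) = 1"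
    using b unfolding chart_def by (intro eventually_ball_finite) auto
  then have ev: "\<forall>\<^sub>F s in nhds \<tau>. b s = (\<lambda>A. \<epsilon> * h' s * ten (\<lambda>i. x' i s) A) \<and> (\<forall>i<r. dot (n i) (e i) (x' i s) = 1)"
    using b[unfolded chart_def, THEN conjunct1] by eventually_elim (auto simp: dot_commute)
  \<comment> \<open>The chart of \<open>b\<close> satisfies exactly the normalization demanded of
    \<open>y\<close> in \<open>chart_ip_vel_acc\<close>, so \<open>y\<close> can be taken as the
    forms of \<open>b s\<close>.\<close>
  have E1: "\<forall>\<^sub>F s in nhds \<tau>. h' s * ?vs s = ip S w (vel c t) (b s)"
    using ev
  proof eventually_elim
    case (elim s)
    then show ?case using chart_ip_vel_acc(1)[OF c \<epsilon>, of "\<lambda>i. x' i s" "h' s"] by simp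
  qed
  have E2: "\<forall>\<^sub>F s in nhds \<tau>. h' s * (h2 + (?zs s + (?vs s * ?vs s + (-1) * ?qs s))) = ip S w (acc c t) (b s)"
    using ev
  proof eventually_elim
    case (elim s)
    then show ?case using chart_ip_vel_acc(2)[OF c \<epsilon>, of "\<lambda>i. x' i s" "h' s"]
      by (simp add: algebra_simps power2_eq_square)
  qed
  \<comment> \<open>The value is 0 because \<open>v i\<close> is orthogonal to \<open>e i\<close>;
    hence the squares below contribute only in second order.\<close>
  have jv: "jet2 (\<lambda>s. dot (n i) (v i) (x' i s)) \<tau> 0 (dot (n i) (v i) (v' i)) (dot (n i) (v i) (z' i))" if "i < r" for i
    using chart_jet_dot[OF b that, of "v i"] chart_orth(2)[OF c(4) that] by (simp add: dot_commute)
  have jz: "jet2 (\<lambda>s. dot (n i) (z i) (x' i s)) \<tau> 0 (dot (n i) (z i) (v' i)) (dot (n i) (z i) (z' i))" if "i < r" for i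
    using chart_jet_dot[OF b that, of "z i"] chart_orth(3)[OF c(4) that] by (simp add: dot_commute)
  have Jv: "jet2 ?vs \<tau> (\<Sum>i<r. real (d i) * 0) (\<Sum>i<r. real (d i) * dot (n i) (v i) (v' i)) (\<Sum>i<r. real (d i) * dot (n i) (v i) (z' i))"
    by (intro jet2_sum jet2_cmult jv) simp
  have Jz: "jet2 ?zs \<tau> (\<Sum>i<r. real (d i) * 0) (\<Sum>i<r. real (d i) * dot (n i) (z i) (v' i)) (\<Sum>i<r. real (d i) * dot (n i) (z i) (z' i))"
    by (intro jet2_sum jet2_cmult jz) simp
  have "jet2 (\<lambda>s. (dot (n i) (v i) (x' i s))\<^sup>2) \<tau> 0 0 (2 * (dot (n i) (v i) (v' i))\<^sup>2)" if "i < r" for i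
    using jet2_mult[OF jv[OF that] jv[OF that]] by (simp add: power2_eq_square mult.assoc)
  then have Jq: "jet2 ?qs \<tau> (\<Sum>i<r. real (d i) * 0) (\<Sum>i<r. real (d i) * 0) (\<Sum>i<r. real (d i) * (2 * (dot (n i) (v i) (v' i))\<^sup>2))"
    by (intro jet2_sum jet2_cmult) simp
  show "\<exists>D. jet2 (\<lambda>s. ip S w (vel c t) (b s)) \<tau> 0 (\<Sum>i<r. real (d i) * dot (n i) (v i) (v' i)) D"
    using jet2_cong[OF E1 jet2_mult[OF hj Jv]] by auto
  have *: "(\<Sum>i<r. real (d i) * (2 * (dot (n i) (v i) (v' i))\<^sup>2)) = 2 * (\<Sum>i<r. real (d i) * (dot (n i) (v i) (v' i))\<^sup>2)"
    by (simp add: sum_distrib_left mult_ac)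
  show "jet2 (\<lambda>s. ip S w (acc c t) (b s)) \<tau> h2 (\<Sum>i<r. real (d i) * dot (n i) (z i) (v' i))
      (h2' * h2 + (\<Sum>i<r. real (d i) * dot (n i) (z i) (z' i)) + 2 * (\<Sum>i<r. real (d i) * dot (n i) (v i) (v' i))\<^sup>2
      - 2 * (\<Sum>i<r. real (d i) * (dot (n i) (v i) (v' i))\<^sup>2))"
    using jet2_cong[OF E2 jet2_mult[OF hj jet2_add[OF jet2_const[where c = h2] jet2_add[OF Jz
       jet2_add[OF jet2_mult[OF Jv Jv] jet2_cmult[OF Jq[unfolded *], where k = "-1"]]]]]]
    by (simp add: power2_eq_square algebra_simps)
qed

end

subsection \<open>Geodesics and curvature\<close>

lemma dot_self_eq_0:
  assumes "dot n a a = 0" "k \<le> n"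
  shows "a k = 0"
  using assms by (simp add: dot_def sum_nonneg_eq_0_iff)

lemma dot_scale_right: "dot n a (\<lambda>k. c * b k) = c * dot n a b"
  by (simp add: dot_def sum_distrib_left mult_ac)

lemma dot_lincomb_right: "dot n a (\<lambda>k. c * b k + c' * b' k) = c * dot n a b + c' * dot n a b'"
  by (simp add: dot_def sum_distrib_left sum.distrib algebra_simps)

lemma vel_acc_eq_0:
  assumes "open I" "t \<in> I" "\<And>s. s \<in> I \<Longrightarrow> c s A = 0"
  shows "vel c t A = 0" "acc c t A = 0"
proof -
  have "(deriv ^^ k) (\<lambda>s. c s A) t = (deriv ^^ k) (\<lambda>_. 0) t" for k
    using assms by (intro funpow_deriv_cong[OF assms(1)]) auto
  from this[of 1] this[of 2] show "vel c t A = 0" "acc c t A = 0"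
    by (simp_all add: vel_def acc_def numeral_2_eq_2)
qed

context segre_veronese
begin

lemma Xset_outside: "F \<in> X \<Longrightarrow> A \<notin> S \<Longrightarrow> F A = 0"
  by (auto simp: Xset_def tensor_def)

text \<open>Turning the \<open>i\<close>-th form towards a unit vector \<open>y\<close> orthogonal
  to \<open>e i\<close> yields a tangent vector whose pairing with the acceleration is
  \<open>d i\<close> times \<open>dot (n i) (z i) y\<close>. So \<open>z i\<close> is orthogonal to
  all such \<open>y\<close>; being itself orthogonal to \<open>e i\<close>, it must vanish.\<close>

lemma geodesic_imp_chart_zero:
  assumes geo: "geodesic S w X I c" and t: "t \<in> I"
    and ch: "chart \<epsilon> e c t h x h2 v z" and \<epsilon>: "\<epsilon> = 1 \<or> \<epsilon> = -1" and i: "i < r"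
  shows "k \<le> n i \<Longrightarrow> z i k = 0"
proof -
  have c: "open I" "smooth_curve I c"
    and orth: "\<And>u. u \<in> tangent_space X (c t) \<Longrightarrow> ip S w (acc c t) u = 0"
    using geo t unfolding geodesic_def by blast+
  have ee: "\<epsilon> * \<epsilon> = 1" using \<epsilon> by (rule square_sign)
  have orth_z: "dot (n i) (z i) y = 0" if y: "dot (n i) (e i) y = 0" "dot (n i) y y = 1" for y
  proof -
    \<comment> \<open>A great circle through \<open>e i\<close> in slot \<open>i\<close> consists of
      unit vectors, so \<open>b\<close> stays in \<open>X\<close>.\<close>
    define q where "q s j = (if j = i then (\<lambda>k. cos s * e i k + sin s * y k) else e j)" for s j
    define b where "b s = (\<lambda>A. \<epsilon> * ten (q s) A)" for s
    have q_smooth: "smooth_on UNIV (\<lambda>s. q s j k)" for j k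
      unfolding q_def
      by (cases "j = i") (auto intro!: smooth_on_add smooth_on_mult smooth_on_const smooth_on_cos_sin)
    have b_smooth: "smooth_curve UNIV b"
      unfolding b_def by (intro smooth_curve_cmult smooth_curve_tensor smooth_curve_ver q_smooth open_UNIV)
    have q_unit: "dot (n j) (q s j) (q s j) = 1" if "j < r" for s j
    proof (cases "j = i")
      case True
      have "dot (n i) (q s i) (q s i) = cos s * (cos s * 1 + sin s * 0) + sin s * (cos s * 0 + sin s * 1)"
        using y chart_orth(1)[OF ch i] dot_commute[of "n i" y "e i"]
        unfolding q_def by (simp add: dot_lincomb_right dot_commute[of _ "\<lambda>k. _ k + _ k"])
      then show ?thesis using True by (simp add: power2_eq_square[symmetric])
    qed (use chart_orth(1)[OF ch that] in \<open>simp add: q_def\<close>)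
    have "q 0 j = e j" for j by (auto simp: q_def)
    then have b0: "b 0 = c t" unfolding chart_base[OF ch] b_def by simp
    have "b s \<in> X" for s
      unfolding b_def using i \<epsilon> q_unit by (intro Xset_unitI) auto
    then have "vel b 0 \<in> tangent_space X (c t)"
      unfolding tangent_space_def using b_smooth b0
      by (auto intro!: exI[of _ b] exI[of _ 1] simp: smooth_curve_def)
    from orth[OF this] have z0: "ip S w (acc c t) (vel b 0) = 0" .
    have "\<forall>\<^sub>F s in nhds t. \<forall>j\<in>{..<r}. dot (n j) (x j s) (e j) = 1"
      using ch unfolding chart_def by (intro eventually_ball_finite) auto
    with ch[unfolded chart_def, THEN conjunct1]
    have ev: "\<forall>\<^sub>F s in nhds t. real (d i) * (h s * dot (n i) (x i s) y) = ip S w (c s) (vel b 0)"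
    proof eventually_elim
      case (elim s)
      have "ip S w (c s) (b \<sigma>) = h s * (cos \<sigma> + sin \<sigma> * dot (n i) (x i s) y) ^ d i" for \<sigma>
      proof -
        have "ip S w (c s) (b \<sigma>) = (\<epsilon> * \<epsilon>) * h s * (\<Prod>j<r. dot (n j) (x j s) (q \<sigma> j) ^ d j)"
          unfolding b_def elim(1) ip_scale_left ip_scale_right ip_tensor_ver by simp
        also have "(\<Prod>j<r. dot (n j) (x j s) (q \<sigma> j) ^ d j) =
            (\<Prod>j<r. if j = i then (cos \<sigma> + sin \<sigma> * dot (n i) (x i s) y) ^ d i else 1)"
          using elim(2) i by (intro prod.cong) (auto simp: q_def dot_lincomb_right)
        also have "\<dots> = (cos \<sigma> + sin \<sigma> * dot (n i) (x i s) y) ^ d i" using i by (simp add: prod.delta)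
        finally show ?thesis by (simp add: ee)
      qed
      then have "((\<lambda>\<sigma>. h s * (cos \<sigma> + sin \<sigma> * dot (n i) (x i s) y) ^ d i) has_real_derivative ip S w (c s) (vel b 0)) (at 0)"
        using DERIV_ip_smooth_curve[OF open_UNIV b_smooth UNIV_I, where S = S and w = w and v = "c s" and t = 0] by simp
      moreover have "((\<lambda>\<sigma>. h s * (cos \<sigma> + sin \<sigma> * dot (n i) (x i s) y) ^ d i) has_real_derivative
          real (d i) * (h s * dot (n i) (x i s) y)) (at 0)"
        by (auto intro!: derivative_eq_intros)
      ultimately show ?case by (rule DERIV_unique[symmetric])
    qed
    have hj: "jet2 h t 1 0 h2" using ch unfolding chart_def by blast
    from jet2_cong[OF ev jet2_cmult[OF jet2_mult[OF hj chart_jet_dot[OF ch i]]]]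
      jet2_ip_smooth_curve[OF c t, where S = S and w = w and v = "vel b 0"]
    \<comment> \<open>Second derivative of \<open>h\<close> times the product with \<open>y\<close>;
      the other terms die because \<open>h\<close> has derivative 0 and \<open>y\<close> is
      orthogonal to \<open>e i\<close>.\<close>
    have "real (d i) * (1 * dot (n i) (z i) y + 2 * 0 * dot (n i) (v i) y + h2 * dot (n i) (e i) y) =
        ip S w (acc c t) (vel b 0)" by (rule jet2_unique(3))
    then show ?thesis using z0 y d_ge_1[OF i] by simp
  qed
  have "dot (n i) (z i) (z i) = 0"
  proof (rule ccontr)
    assume nz: "dot (n i) (z i) (z i) \<noteq> 0"
    have "dot (n i) (z i) (z i) \<ge> 0" by (simp add: dot_def sum_nonneg)
    with nz have pos: "dot (n i) (z i) (z i) > 0" by simp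
    \<comment> \<open>Scaling by \<open>l\<close> turns \<open>z i\<close> into an admissible unit
      vector \<open>y\<close>.\<close>
    define l where "l = inverse (sqrt (dot (n i) (z i) (z i)))"
    have "dot (n i) (\<lambda>k. l * z i k) (\<lambda>k. l * z i k) = l * (l * dot (n i) (z i) (z i))"
      by (simp add: dot_scale_right dot_commute[of _ "\<lambda>k. _ * _ k"])
    also have "\<dots> = 1" using pos unfolding l_def by (simp add: field_simps)
    finally have "dot (n i) (\<lambda>k. l * z i k) (\<lambda>k. l * z i k) = 1" .
    moreover have "dot (n i) (e i) (\<lambda>k. l * z i k) = 0"
      using chart_orth(3)[OF ch i] by (simp add: dot_scale_right dot_commute)
    ultimately have "dot (n i) (z i) (\<lambda>k. l * z i k) = 0" by (intro orth_z)
    then show False using pos unfolding dot_scale_right l_def by simp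
  qed
  then show "k \<le> n i \<Longrightarrow> z i k = 0" by (rule dot_self_eq_0)
qed

text \<open>Converse direction: a tangent vector is the velocity of some curve \<open>b\<close>
  through the same point. Charting \<open>b\<close> at that base point, its pairing with the
  acceleration is a sum of terms linear in the second derivatives \<open>z\<close>, here all
  0.\<close>

lemma geodesicI_chart:
  assumes c: "open I" "smooth_curve I c" "\<forall>t\<in>I. c t \<in> X"
    and ch: "\<And>t. t \<in> I \<Longrightarrow> \<exists>\<epsilon> e h x h2 v. (\<epsilon> = 1 \<or> \<epsilon> = -1) \<and> chart \<epsilon> e c t h x h2 v (\<lambda>_ _. 0)"
  shows "geodesic S w X I c"
  unfolding geodesic_def
proof (intro conjI ballI c)
  fix t u assume t: "t \<in> I" and "u \<in> tangent_space X (c t)"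
  then obtain b \<delta> where b: "u = vel b 0" "0 < \<delta>" "smooth_curve (ball 0 \<delta>) b" "\<forall>s\<in>ball 0 \<delta>. b s \<in> X" "b 0 = c t"
    unfolding tangent_space_def by blast
  obtain \<epsilon> e h x h2 v where \<epsilon>: "\<epsilon> = 1 \<or> \<epsilon> = -1" and cht: "chart \<epsilon> e c t h x h2 v (\<lambda>_ _. 0)"
    using ch[OF t] by blast
  have 0: "0 \<in> ball 0 \<delta>" using b by simp
  obtain h' x' h2' v' z' where "chart \<epsilon> e b 0 h' x' h2' v' z'"
    using chart_exists[OF open_ball b(3) 0 b(4) \<epsilon> chart_orth(1)[OF cht] b(5)[unfolded chart_base[OF cht]]] by blast
  from jet2_DERIV[OF chart_jets_vel_acc(2)[OF c(1,2) t cht square_sign[OF \<epsilon>] this]]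
  have "((\<lambda>s. ip S w (acc c t) (b s)) has_real_derivative 0) (at 0)" by (simp add: dot_def)
  from DERIV_unique[OF DERIV_ip_smooth_curve[OF open_ball b(3) 0] this]
  show "ip S w (acc c t) u = 0" unfolding b(1) .
qed (use c in blast)

text \<open>The case \<open>b = c\<close> of the first order pairing.\<close>

lemma chart_speed:
  assumes c: "open I" "smooth_curve I c" "t \<in> I" "chart \<epsilon> e c t h x h2 v z" "\<epsilon> * \<epsilon> = 1"
  shows "ip S w (vel c t) (vel c t) = (\<Sum>i<r. real (d i) * dot (n i) (v i) (v i))"
proof -
  obtain D where "jet2 (\<lambda>s. ip S w (vel c t) (c s)) t 0 (\<Sum>i<r. real (d i) * dot (n i) (v i) (v i)) D"
    using chart_jets_vel_acc(1)[OF c c(4)] by blast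
  from DERIV_unique[OF DERIV_ip_smooth_curve[OF c(1-3)] jet2_DERIV[OF this]] show ?thesis .
qed

lemma curvature_chart:
  assumes geo: "geodesic S w X I c" and t: "t \<in> I" and unit: "nrm S w (vel c t) = 1"
    and ch: "chart \<epsilon> e c t h x h2 v z" and \<epsilon>: "\<epsilon> = 1 \<or> \<epsilon> = -1"
  shows "curvature S w X c t = sqrt (2 - 2 * (\<Sum>i<r. real (d i) * (dot (n i) (v i) (v i))\<^sup>2))"
proof -
  have c: "open I" "smooth_curve I c" "\<forall>t\<in>I. c t \<in> X"
    and orth: "\<And>u. u \<in> tangent_space X (c t) \<Longrightarrow> ip S w (acc c t) u = 0"
    using geo t unfolding geodesic_def by blast+
  have ee: "\<epsilon> * \<epsilon> = 1" using \<epsilon> by (rule square_sign)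
  have V: "ip S w (vel c t) (vel c t) = 1" using unit by (simp add: nrm_def)
  have G: "ip S w (c t) (c t) = 1" using c t Xset_norm by blast
  have A: "ip S w (acc c t) (c t) = -1" using ip_vel_acc_Xset(2)[OF c t] V by simp
  have z: "z i k = 0" if "i < r" "k \<le> n i" for i k
    using geodesic_imp_chart_zero[OF geo t ch \<epsilon> that] .
  note J = chart_jets_vel_acc(2)[OF c(1,2) t ch ee ch]
  \<comment> \<open>Both sides are the pairing of the acceleration with the point itself.\<close>
  have h2: "h2 = -1" using jet2_value[OF J] A by simp
  have "jet2 (\<lambda>s. ip S w (acc c t) (c s)) t (ip S w (acc c t) (c t)) (ip S w (acc c t) (vel c t)) (ip S w (acc c t) (acc c t))"
    using jet2_ip_smooth_curve[OF c(1,2) t, where S = S and w = w and v = "acc c t"] by (simp add: ip_commute)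
  from jet2_unique(3)[OF this J]
  have "ip S w (acc c t) (acc c t) = h2 * h2 + (\<Sum>i<r. real (d i) * dot (n i) (z i) (z i))
      + 2 * (\<Sum>i<r. real (d i) * dot (n i) (v i) (v i))\<^sup>2 - 2 * (\<Sum>i<r. real (d i) * (dot (n i) (v i) (v i))\<^sup>2)" .
  moreover have "(\<Sum>i<r. real (d i) * dot (n i) (v i) (v i)) = 1"
    using chart_speed[OF c(1,2) t ch ee] V by simp
  moreover have "(\<Sum>i<r. real (d i) * dot (n i) (z i) (z i)) = 0"
    using z by (intro sum.neutral) (simp add: dot_def)
  ultimately have aa: "ip S w (acc c t) (acc c t) = 3 - 2 * (\<Sum>i<r. real (d i) * (dot (n i) (v i) (v i))\<^sup>2)"
    using h2 by simp
  \<comment> \<open>The acceleration is already orthogonal to the tangent space and has component -1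
    along \<open>c t\<close>; adding \<open>c t\<close> removes that component and leaves the normal
    part.\<close>
  define p where "p = (\<lambda>A. acc c t A + c t A)"
  have "c s A = 0" if "s \<in> I" "A \<notin> S" for s A using that c(3) Xset_outside by blast
  then have "p A = 0" if "A \<notin> S" for A
    using that t vel_acc_eq_0(2)[OF c(1) t, of c A] unfolding p_def by simp
  then have pN: "p \<in> normal_space S w X (c t)"
    using A G orth tangent_space_orth unfolding normal_space_def coord_space_def p_def
    by (simp add: ip_add_left)
  have "ip S w (\<lambda>A. acc c t A - p A) u = 0" if "u \<in> normal_space S w X (c t)" for u
  proof -
    have "(\<lambda>A. acc c t A - p A) = (\<lambda>A. (-1) * c t A)" by (simp add: p_def)
    then show ?thesis using that unfolding normal_space_def by (simp only: ip_scale_left) (simp add: ip_commute)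
  qed
  then have "proj S w (normal_space S w X (c t)) (acc c t) = p"
    using pN by (intro proj_eqI finite_Idx tw_pos)
  moreover have "ip S w p p = ip S w (acc c t) (acc c t) - 1"
    using A G unfolding p_def ip_add_left ip_commute[of S w _ "\<lambda>A. _ A + _ A"]
    by (simp add: ip_commute[of S w "c t" "acc c t"])
  ultimately show ?thesis unfolding curvature_def nrm_def aa by simp
qed

end

subsection \<open>Products of geodesics\<close>

lemma Vset_outside: "F \<in> Vset n d \<Longrightarrow> \<alpha> \<notin> Mon n d \<Longrightarrow> F \<alpha> = 0"
  by (auto simp: Vset_def ver_def)

text \<open>With one factor, tensor coordinates are singleton lists; this identifies the Veronese
  manifold with a one-factor \<open>Xset\<close>.\<close>

lemma Idx_1: "Idx (Suc 0) (\<lambda>_. m) (\<lambda>_. k) = (\<lambda>\<alpha>. [\<alpha>]) ` Mon m k"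
  by (auto simp: Idx_def length_Suc_conv)

lemma ip_Idx_1:
  "ip (Idx (Suc 0) (\<lambda>_. m) (\<lambda>_. k)) (tw (Suc 0) (\<lambda>_. m) (\<lambda>_. k)) F G =
   ip (Mon m k) (bw_w m k) (\<lambda>\<alpha>. F [\<alpha>]) (\<lambda>\<alpha>. G [\<alpha>])"
  unfolding ip_def Idx_1 by (subst sum.reindex) (auto simp: inj_on_def tw_def)

lemma tensor_1:
  assumes "F \<in> Vset m k"
  shows "tensor (Suc 0) (\<lambda>_. m) (\<lambda>_. k) (\<lambda>_. F) [\<alpha>] = F \<alpha>"
  using Vset_outside[OF assms] by (auto simp: tensor_def Idx_1)

lemma ip_cong:
  "(\<And>A. A \<in> S \<Longrightarrow> F A = F' A) \<Longrightarrow> (\<And>A. A \<in> S \<Longrightarrow> G A = G' A) \<Longrightarrow> ip S w F G = ip S w F' G'"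
  by (simp add: ip_def)

lemma vel_acc_tensor_1:
  assumes "\<alpha> \<in> Mon m k"
  shows "vel (\<lambda>s. tensor (Suc 0) (\<lambda>_. m) (\<lambda>_. k) (\<lambda>_. f s)) t [\<alpha>] = vel f t \<alpha>"
    and "acc (\<lambda>s. tensor (Suc 0) (\<lambda>_. m) (\<lambda>_. k) (\<lambda>_. f s)) t [\<alpha>] = acc f t \<alpha>"
  using assms by (simp_all add: vel_def acc_def tensor_def Idx_1)

text \<open>Reading coordinates at \<open>[\<alpha>]\<close> preserves inner products and carries
  test curves in the one-factor \<open>Xset\<close> back to curves in \<open>Vset\<close>, so the
  orthogonality condition transfers.\<close>

lemma geodesic_Vset_Xset:
  assumes "geodesic (Mon m k) (bw_w m k) (Vset m k) I f"
  shows "geodesic (Idx (Suc 0) (\<lambda>_. m) (\<lambda>_. k)) (tw (Suc 0) (\<lambda>_. m) (\<lambda>_. k)) (Xset (Suc 0) (\<lambda>_. m) (\<lambda>_. k)) I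
    (\<lambda>s. tensor (Suc 0) (\<lambda>_. m) (\<lambda>_. k) (\<lambda>_. f s))"
  unfolding geodesic_def
proof (intro conjI ballI)
  have f: "open I" "smooth_curve I f" "\<And>t. t \<in> I \<Longrightarrow> f t \<in> Vset m k"
    and orth: "\<And>t u. t \<in> I \<Longrightarrow> u \<in> tangent_space (Vset m k) (f t) \<Longrightarrow> ip (Mon m k) (bw_w m k) (acc f t) u = 0"
    using assms unfolding geodesic_def by blast+
  show "open I" by fact
  show "smooth_curve I (\<lambda>s. tensor (Suc 0) (\<lambda>_. m) (\<lambda>_. k) (\<lambda>_. f s))"
    using f by (intro smooth_curve_tensor)
  show "tensor (Suc 0) (\<lambda>_. m) (\<lambda>_. k) (\<lambda>_. f t) \<in> Xset (Suc 0) (\<lambda>_. m) (\<lambda>_. k)" if "t \<in> I" for t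
    using f(3)[OF that] unfolding Xset_def by blast
  fix t u assume t: "t \<in> I"
    and "u \<in> tangent_space (Xset (Suc 0) (\<lambda>_. m) (\<lambda>_. k)) (tensor (Suc 0) (\<lambda>_. m) (\<lambda>_. k) (\<lambda>_. f t))"
  then obtain b \<delta> where b: "u = vel b 0" "0 < \<delta>" "smooth_curve (ball 0 \<delta>) b"
    "\<forall>s\<in>ball 0 \<delta>. b s \<in> Xset (Suc 0) (\<lambda>_. m) (\<lambda>_. k)" "b 0 = tensor (Suc 0) (\<lambda>_. m) (\<lambda>_. k) (\<lambda>_. f t)"
    unfolding tangent_space_def by blast
  define g where "g s = (\<lambda>\<alpha>. b s [\<alpha>])" for s
  have "g s \<in> Vset m k" if "s \<in> ball 0 \<delta>" for s
  proof -
    obtain fs where fs: "b s = tensor (Suc 0) (\<lambda>_. m) (\<lambda>_. k) fs" "fs 0 \<in> Vset m k"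
      using b(4)[rule_format, OF \<open>s \<in> ball 0 \<delta>\<close>] unfolding Xset_def by auto
    have "b s = tensor (Suc 0) (\<lambda>_. m) (\<lambda>_. k) (\<lambda>_. fs 0)"
      unfolding fs(1) by (rule tensor_cong) simp
    then have "g s = fs 0" unfolding g_def using tensor_1[OF fs(2)] by auto
    then show ?thesis using fs(2) by simp
  qed
  moreover have "smooth_curve (ball 0 \<delta>) g" using b(3) unfolding g_def smooth_curve_def by blast
  moreover have "g 0 = f t" unfolding g_def b(5) using tensor_1[OF f(3)[OF t]] by auto
  ultimately have "vel g 0 \<in> tangent_space (Vset m k) (f t)"
    using b(2) unfolding tangent_space_def by blast
  from orth[OF t this]
  show "ip (Idx (Suc 0) (\<lambda>_. m) (\<lambda>_. k)) (tw (Suc 0) (\<lambda>_. m) (\<lambda>_. k)) (acc (\<lambda>s. tensor (Suc 0) (\<lambda>_. m) (\<lambda>_. k) (\<lambda>_. f s)) t) u = 0"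
    unfolding ip_Idx_1 b(1)
    by (subst ip_cong[where F' = "acc f t" and G' = "vel g 0"])
      (simp_all add: vel_acc_tensor_1, simp add: vel_def g_def)
qed

text \<open>The one-slot analogue of \<open>chart\<close> for a geodesic: second derivatives of the
  form are 0, and the speed is expressed through \<open>v\<close>.\<close>

definition factor_chart where
  "factor_chart m k f t \<epsilon> e h x h2 v \<longleftrightarrow>
    (\<epsilon> = 1 \<or> \<epsilon> = (-1 :: real)) \<and> (\<forall>\<^sub>F s in nhds t. f s = (\<lambda>\<alpha>. \<epsilon> * h s * ver m k (x s) \<alpha>)) \<and>
    jet2 h t 1 0 h2 \<and> (\<forall>j\<le>m. jet2 (\<lambda>s. x s j) t (e j) (v j) 0) \<and>
    (\<forall>\<^sub>F s in nhds t. dot m (x s) e = 1) \<and>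
    ip (Mon m k) (bw_w m k) (vel f t) (vel f t) = real k * dot m v v"

lemma Vset_geodesic_chart:
  assumes geo: "geodesic (Mon m k) (bw_w m k) (Vset m k) I f" and t: "t \<in> I" and k: "k \<ge> 1"
  shows "\<exists>\<epsilon> e h x h2 v. factor_chart m k f t \<epsilon> e h x h2 v"
proof -
  interpret segre_veronese "Suc 0" "\<lambda>_. m" "\<lambda>_. k" using k by unfold_locales
  let ?c = "\<lambda>s. tensor (Suc 0) (\<lambda>_. m) (\<lambda>_. k) (\<lambda>_. f s)"
  note geo' = geodesic_Vset_Xset[OF geo]
  have c: "open I" "smooth_curve I ?c" "\<forall>t\<in>I. ?c t \<in> X" using geo' unfolding geodesic_def by blast+
  have f: "f s \<in> Vset m k" if "s \<in> I" for s using geo that unfolding geodesic_def by blast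
  have ctX: "?c t \<in> X" using c t by blast
  obtain \<epsilon> e where \<epsilon>: "\<epsilon> = 1 \<or> \<epsilon> = -1" and e: "\<And>i. i < Suc 0 \<Longrightarrow> dot m (e i) (e i) = 1" and ct: "?c t = (\<lambda>A. \<epsilon> * ten e A)"
    by (rule Xset_unit[OF ctX]) blast
  obtain h x h2 v z where ch: "chart \<epsilon> e ?c t h x h2 v z"
    using chart_exists[OF c(1,2) t c(3) \<epsilon> e ct] by blast
  have z: "z 0 j = 0" if "j \<le> m" for j
    using geodesic_imp_chart_zero[OF geo' t ch \<epsilon>, of 0] that by simp
  have "\<forall>\<^sub>F s in nhds t. s \<in> I" using c(1) t by (auto simp: eventually_nhds)
  with ch[unfolded chart_def, THEN conjunct1]
  have "\<forall>\<^sub>F s in nhds t. f s = (\<lambda>\<alpha>. \<epsilon> * h s * ver m k (x 0 s) \<alpha>)"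
  proof eventually_elim
    case (elim s)
    show ?case
    proof
      fix \<alpha>
      have "f s \<alpha> = ?c s [\<alpha>]" using tensor_1[OF f[OF elim(2)]] by simp
      also have "\<dots> = \<epsilon> * h s * ten (\<lambda>i. x i s) [\<alpha>]" using elim(1) by metis
      also have "ten (\<lambda>i. x i s) [\<alpha>] = ver m k (x 0 s) \<alpha>"
        unfolding tensor_def Idx_1 by (auto simp: ver_def)
      finally show "f s \<alpha> = \<epsilon> * h s * ver m k (x 0 s) \<alpha>" .
    qed
  qed
  moreover have "ip (Mon m k) (bw_w m k) (vel f t) (vel f t) = ip S w (vel ?c t) (vel ?c t)"
    unfolding ip_Idx_1 by (intro ip_cong) (simp_all add: vel_acc_tensor_1)
  then have "ip (Mon m k) (bw_w m k) (vel f t) (vel f t) = real k * dot m (v 0) (v 0)"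
    unfolding chart_speed[OF c(1,2) t ch square_sign[OF \<epsilon>]] by simp
  moreover have "jet2 h t 1 0 h2" "\<forall>j\<le>m. jet2 (\<lambda>s. x 0 s j) t (e 0 j) (v 0 j) 0" "\<forall>\<^sub>F s in nhds t. dot m (x 0 s) (e 0) = 1"
    using ch z unfolding chart_def by fastforce+
  ultimately have "factor_chart m k f t \<epsilon> (e 0) h (x 0) h2 (v 0)"
    unfolding factor_chart_def using \<epsilon> by blast
  then show ?thesis by blast
qed

context segre_veronese
begin

text \<open>Charts of the factors multiply: signs and scale functions are collected, the forms are
  kept, and the second derivatives of the forms stay 0.\<close>

lemma tensor_geodesic_chart:
  assumes geo: "\<And>i. i < r \<Longrightarrow> geodesic (Mon (n i) (d i)) (bw_w (n i) (d i)) (Vset (n i) (d i)) I (f i)"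
    and t: "t \<in> I"
  shows "\<exists>\<epsilon> e h x h2 v. (\<epsilon> = 1 \<or> \<epsilon> = -1) \<and> chart \<epsilon> e (\<lambda>s. tensor r n d (\<lambda>i. f i s)) t h x h2 v (\<lambda>_ _. 0) \<and>
    (\<forall>i<r. ip (Mon (n i) (d i)) (bw_w (n i) (d i)) (vel (f i) t) (vel (f i) t) = real (d i) * dot (n i) (v i) (v i))"
proof -
  have "\<forall>i. \<exists>\<epsilon> e h x h2 v. i < r \<longrightarrow> factor_chart (n i) (d i) (f i) t \<epsilon> e h x h2 v"
    using Vset_geodesic_chart[OF geo t d_ge_1] by blast
  then obtain \<epsilon> e h x h2 v where
    "\<And>i. i < r \<Longrightarrow> factor_chart (n i) (d i) (f i) t (\<epsilon> i) (e i) (h i) (x i) (h2 i) (v i)" by metis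
  note * = this[unfolded factor_chart_def]
  let ?\<epsilon> = "\<Prod>i<r. \<epsilon> i" and ?h = "\<lambda>s. \<Prod>i<r. h i s"
  have "\<bar>\<epsilon> i\<bar> = 1" if "i < r" for i using * that by fastforce
  then have "\<bar>?\<epsilon>\<bar> = 1" unfolding abs_prod by (intro prod.neutral) simp
  then have sgn: "?\<epsilon> = 1 \<or> ?\<epsilon> = -1" by linarith
  have "\<forall>\<^sub>F s in nhds t. \<forall>i\<in>{..<r}. f i s = (\<lambda>\<alpha>. \<epsilon> i * h i s * ver (n i) (d i) (x i s) \<alpha>)"
    using * by (intro eventually_ball_finite) auto
  then have ev: "\<forall>\<^sub>F s in nhds t. tensor r n d (\<lambda>i. f i s) = (\<lambda>A. ?\<epsilon> * ?h s * ten (\<lambda>i. x i s) A)"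
  proof eventually_elim
    case (elim s)
    then have "tensor r n d (\<lambda>i. f i s) = tensor r n d (\<lambda>i \<alpha>. (\<epsilon> i * h i s) * ver (n i) (d i) (x i s) \<alpha>)"
      by (intro tensor_cong) simp
    then show ?case unfolding tensor_scale prod.distrib .
  qed
  \<comment> \<open>Exponent 1 brings the product into the shape of
    \<open>jet2_prod_power_one\<close>; as all first derivatives vanish, the second ones simply
    add.\<close>
  have "jet2 (\<lambda>s. \<Prod>i<r. h i s ^ 1) t 1 (\<Sum>i<r. real 1 * 0)
      ((\<Sum>i<r. real 1 * h2 i) + (\<Sum>i<r. real 1 * 0)\<^sup>2 - (\<Sum>i<r. real 1 * 0\<^sup>2))"
    by (rule jet2_prod_power_one) (use * in blast)
  then have "jet2 ?h t 1 0 (\<Sum>i<r. h2 i)" by simp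
  then have "chart ?\<epsilon> e (\<lambda>s. tensor r n d (\<lambda>i. f i s)) t ?h x (\<Sum>i<r. h2 i) v (\<lambda>_ _. 0)"
    unfolding chart_def using ev * by blast
  then show ?thesis using sgn * by blast
qed

text \<open>The product chart has vanishing second derivatives, hence is geodesic. With \<theta> i =
  \<open>dot (n i) (v i) (v i)\<close>, the speed of a factor gives \<open>d i\<close> \<theta> i =
  \<open>(\<rho> i)^2\<close>, which turns the curvature formula into fourth powers of the
  speeds.\<close>

lemma tensor_geodesic:
  assumes geo: "\<And>i. i < r \<Longrightarrow> geodesic (Mon (n i) (d i)) (bw_w (n i) (d i)) (Vset (n i) (d i)) I (f i)"
    and speed: "\<And>i s. i < r \<Longrightarrow> s \<in> I \<Longrightarrow> nrm (Mon (n i) (d i)) (bw_w (n i) (d i)) (vel (f i) s) = \<rho> i"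
    and one: "(\<Sum>i<r. (\<rho> i)\<^sup>2) = 1"
  shows "geodesic S w X I (\<lambda>s. tensor r n d (\<lambda>i. f i s))"
    and "\<forall>s\<in>I. nrm S w (vel (\<lambda>s. tensor r n d (\<lambda>i. f i s)) s) = 1"
    and "\<forall>t\<in>I. curvature S w X (\<lambda>s. tensor r n d (\<lambda>i. f i s)) t = sqrt (2 - 2 * (\<Sum>i<r. (\<rho> i) ^ 4 / real (d i)))"
proof -
  let ?c = "\<lambda>s. tensor r n d (\<lambda>i. f i s)"
  have "r \<noteq> 0" using one by (cases "r = 0") auto
  then have I: "open I" using geo[of 0] unfolding geodesic_def by blast
  have sm: "smooth_curve I ?c" using geo I unfolding geodesic_def by (intro smooth_curve_tensor) auto
  have cX: "\<forall>t\<in>I. ?c t \<in> X" using geo unfolding geodesic_def Xset_def by blast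
  have charts: "\<exists>\<epsilon> e h x h2 v. (\<epsilon> = 1 \<or> \<epsilon> = -1) \<and> chart \<epsilon> e ?c t h x h2 v (\<lambda>_ _. 0) \<and>
      (\<forall>i<r. ip (Mon (n i) (d i)) (bw_w (n i) (d i)) (vel (f i) t) (vel (f i) t) = real (d i) * dot (n i) (v i) (v i))"
    if "t \<in> I" for t
    using geo that by (rule tensor_geodesic_chart)
  show G: "geodesic S w X I ?c"
  proof (rule geodesicI_chart[OF I sm cX])
    fix t assume "t \<in> I"
    from charts[OF this] show "\<exists>\<epsilon> e h x h2 v. (\<epsilon> = 1 \<or> \<epsilon> = -1) \<and> chart \<epsilon> e ?c t h x h2 v (\<lambda>_ _. 0)"
      by (elim exE conjE) (intro exI conjI; assumption)
  qed
  have main: "nrm S w (vel ?c t) = 1 \<and> curvature S w X ?c t = sqrt (2 - 2 * (\<Sum>i<r. (\<rho> i) ^ 4 / real (d i)))"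
    if t: "t \<in> I" for t
  proof -
    obtain \<epsilon> e h x h2 v where \<epsilon>: "\<epsilon> = 1 \<or> \<epsilon> = -1" and ch: "chart \<epsilon> e ?c t h x h2 v (\<lambda>_ _. 0)"
      and ip: "\<forall>i<r. ip (Mon (n i) (d i)) (bw_w (n i) (d i)) (vel (f i) t) (vel (f i) t) = real (d i) * dot (n i) (v i) (v i)"
      using charts[OF t] by (elim exE conjE) (rule that)
    have dv: "real (d i) * dot (n i) (v i) (v i) = (\<rho> i)\<^sup>2" if "i < r" for i
    proof -
      have "dot (n i) (v i) (v i) \<ge> 0" by (simp add: dot_def sum_nonneg)
      then show ?thesis
        unfolding speed[OF that t, symmetric] nrm_def ip[rule_format, OF that] by simp
    qed
    have "real (d i) * (dot (n i) (v i) (v i))\<^sup>2 = (\<rho> i) ^ 4 / real (d i)" if "i < r" for i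
    proof -
      have "(\<rho> i) ^ 4 = (real (d i) * dot (n i) (v i) (v i))\<^sup>2"
        unfolding dv[OF that] by (simp add: power_mult[symmetric])
      then show ?thesis using d_ge_1[OF that] by (simp add: power2_eq_square field_simps)
    qed
    then have q: "(\<Sum>i<r. real (d i) * (dot (n i) (v i) (v i))\<^sup>2) = (\<Sum>i<r. (\<rho> i) ^ 4 / real (d i))"
      by (intro sum.cong) auto
    have u: "nrm S w (vel ?c t) = 1"
      unfolding nrm_def chart_speed[OF I sm t ch square_sign[OF \<epsilon>]] using dv one by simp
    from curvature_chart[OF G t u ch \<epsilon>] show ?thesis unfolding q using u by simp
  qed
  show "\<forall>s\<in>I. nrm S w (vel ?c s) = 1"
    "\<forall>t\<in>I. curvature S w X ?c t = sqrt (2 - 2 * (\<Sum>i<r. (\<rho> i) ^ 4 / real (d i)))"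
    using main by blast+
qed

lemma curvature_formula:
  assumes geo: "geodesic S w X I c" and t: "t \<in> I" and unit: "nrm S w (vel c t) = 1"
  obtains \<theta> where "\<And>i. i < r \<Longrightarrow> \<theta> i \<ge> 0" "(\<Sum>i<r. real (d i) * \<theta> i) = 1"
    "curvature S w X c t = sqrt (2 - 2 * (\<Sum>i<r. real (d i) * (\<theta> i)\<^sup>2))"
proof -
  have c: "open I" "smooth_curve I c" "\<forall>t\<in>I. c t \<in> X" using geo unfolding geodesic_def by blast+
  have ctX: "c t \<in> X" using c t by blast
  obtain \<epsilon> e where \<epsilon>: "\<epsilon> = 1 \<or> \<epsilon> = -1" and e: "\<And>i. i < r \<Longrightarrow> dot (n i) (e i) (e i) = 1" and ct: "c t = (\<lambda>A. \<epsilon> * ten e A)"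
    by (rule Xset_unit[OF ctX]) blast
  obtain h x h2 v z where ch: "chart \<epsilon> e c t h x h2 v z"
    using chart_exists[OF c(1,2) t c(3) \<epsilon> e ct] by blast
  show ?thesis
  proof (rule that[of "\<lambda>i. dot (n i) (v i) (v i)"])
    show "dot (n i) (v i) (v i) \<ge> 0" for i by (simp add: dot_def sum_nonneg)
    show "(\<Sum>i<r. real (d i) * dot (n i) (v i) (v i)) = 1"
      using chart_speed[OF c(1,2) t ch square_sign[OF \<epsilon>]] unit by (simp add: nrm_def)
    show "curvature S w X c t = sqrt (2 - 2 * (\<Sum>i<r. real (d i) * (dot (n i) (v i) (v i))\<^sup>2))"
      by (rule curvature_chart[OF geo t unit ch \<epsilon>])
  qed
qed

end

section \<open>Extremal bounds for the curvature and the equality cases\<close>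

lemma weighted_squares_bounds:
  fixes d \<theta> :: "nat \<Rightarrow> real"
  assumes d: "\<And>i. i < r \<Longrightarrow> d i \<ge> m" and "m > 0" and th: "\<And>i. i < r \<Longrightarrow> \<theta> i \<ge> 0" and one: "(\<Sum>i<r. d i * \<theta> i) = 1"
  shows "1 / (\<Sum>i<r. d i) \<le> (\<Sum>i<r. d i * (\<theta> i)\<^sup>2)" and "(\<Sum>i<r. d i * (\<theta> i)\<^sup>2) \<le> 1 / m"
proof -
  let ?D = "\<Sum>i<r. d i" and ?q = "\<Sum>i<r. d i * (\<theta> i)\<^sup>2"
  have dpos: "d i > 0" if "i < r" for i using d[OF that] \<open>m > 0\<close> by simp
  have "r \<noteq> 0" using one by (cases "r = 0") auto
  then have D: "?D > 0" using dpos by (intro sum_pos) auto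
  \<comment> \<open>A weighted variance: the constant \<open>1 / ?D\<close> is the weighted mean of
    \<open>\<theta>\<close>, by the constraint.\<close>
  have "0 \<le> (\<Sum>i<r. d i * (\<theta> i - 1 / ?D)\<^sup>2)"
    using dpos by (intro sum_nonneg) (simp add: less_imp_le)
  also have "\<dots> = (\<Sum>i<r. d i * (\<theta> i)\<^sup>2 - 2 / ?D * (d i * \<theta> i) + (1 / ?D)\<^sup>2 * d i)"
    by (intro sum.cong refl) (simp add: power2_eq_square algebra_simps)
  also have "\<dots> = ?q - 2 / ?D * (\<Sum>i<r. d i * \<theta> i) + (1 / ?D)\<^sup>2 * ?D"
    by (simp only: sum.distrib sum_subtractf sum_distrib_left)
  also have "\<dots> = ?q - 1 / ?D" unfolding one using D by (simp add: power2_eq_square)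
  finally show "1 / ?D \<le> ?q" by simp
  \<comment> \<open>No single term of the constraint exceeds the total 1, and \<open>d i\<close> is
    at least \<open>m\<close>; one factor of each square is then replaced by this bound.\<close>
  have le: "\<theta> i \<le> 1 / m" if i: "i < r" for i
  proof -
    have "m * \<theta> i \<le> d i * \<theta> i" using d[OF i] th[OF i] by (intro mult_right_mono)
    also have "\<dots> \<le> (\<Sum>i<r. d i * \<theta> i)"
      using i dpos th by (intro member_le_sum) (auto simp: less_imp_le)
    finally show ?thesis using one \<open>m > 0\<close> by (simp add: field_simps)
  qed
  have "?q \<le> (\<Sum>i<r. 1 / m * (d i * \<theta> i))"
  proof (rule sum_mono)
    fix i assume "i \<in> {..<r}"
    then have "\<theta> i * (d i * \<theta> i) \<le> 1 / m * (d i * \<theta> i)"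
      using le th dpos[of i] by (intro mult_right_mono) auto
    then show "d i * (\<theta> i)\<^sup>2 \<le> 1 / m * (d i * \<theta> i)" by (simp add: power2_eq_square mult_ac)
  qed
  also have "\<dots> = 1 / m" unfolding sum_distrib_left[symmetric] one by simp
  finally show "?q \<le> 1 / m" .
qed

text \<open>The curve is constant only on \<open>I\<close>; openness of \<open>I\<close> still makes
  all its derivatives there agree with those of a constant.\<close>

lemma geodesic_const:
  assumes "open I" "f0 \<in> M" "\<And>s. s \<in> I \<Longrightarrow> f s = f0"
  shows "geodesic S w M I f" and "\<And>s. s \<in> I \<Longrightarrow> nrm S w (vel f s) = 0"
proof -
  have "(deriv ^^ k) (\<lambda>s. f s A) t = (deriv ^^ k) (\<lambda>_. f0 A) t" if "t \<in> I" for A k t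
    using assms(3) by (intro funpow_deriv_cong[OF assms(1) _ that]) simp
  from this[of _ 1] this[of _ 2] have "vel f t = (\<lambda>_. 0)" "acc f t = (\<lambda>_. 0)" if "t \<in> I" for t
    using that by (simp_all add: vel_def acc_def numeral_2_eq_2)
  moreover have "smooth_curve I f"
    unfolding smooth_curve_iff
  proof
    fix A show "smooth_on I (\<lambda>s. f s A)"
      by (rule smooth_on_cong[OF assms(1) _ smooth_on_const[OF assms(1), of "f0 A"]]) (simp add: assms(3))
  qed
  ultimately show "geodesic S w M I f" "\<And>s. s \<in> I \<Longrightarrow> nrm S w (vel f s) = 0"
    using assms by (simp_all add: geodesic_def nrm_def ip_def)
qed

theorem theorem1p2:
  fixes r :: nat and n dg :: "nat \<Rightarrow> nat"
  assumes "\<forall>i<r. n i \<ge> 1" and "\<forall>i<r. dg i \<ge> 1"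
    and "(\<Sum>i<r. dg i) \<ge> 2"
  shows
   "let S = Idx r n dg; w = tw r n dg; X = Xset r n dg;
        D = real (\<Sum>i<r. dg i); dl = real (Min (dg ` {..<r}));
        up = sqrt (2 * (D - 1) / D); lo = sqrt (2 * (dl - 1) / dl)
    in
    (\<forall>I \<gamma> t. geodesic S w X I \<gamma> \<and> (\<forall>s\<in>I. nrm S w (vel \<gamma> s) = 1) \<and> t \<in> I
        \<longrightarrow> lo \<le> curvature S w X \<gamma> t \<and> curvature S w X \<gamma> t \<le> up)
    \<and>
    (\<forall>I \<gamma>s. (\<forall>i<r. geodesic (Mon (n i) (dg i)) (bw_w (n i) (dg i)) (Vset (n i) (dg i)) I (\<gamma>s i)
                  \<and> (\<forall>s\<in>I. nrm (Mon (n i) (dg i)) (bw_w (n i) (dg i)) (vel (\<gamma>s i) s)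
                              = sqrt (real (dg i) / D)))
        \<longrightarrow> (let \<gamma> = (\<lambda>s. tensor r n dg (\<lambda>i. \<gamma>s i s)) in
              geodesic S w X I \<gamma> \<and> (\<forall>s\<in>I. nrm S w (vel \<gamma> s) = 1)
              \<and> (\<forall>t\<in>I. curvature S w X \<gamma> t = up)))
    \<and>
    (\<forall>I \<gamma>s l. l < r \<and> real (dg l) = dl
        \<and> geodesic (Mon (n l) (dg l)) (bw_w (n l) (dg l)) (Vset (n l) (dg l)) I (\<gamma>s l)
        \<and> (\<forall>s\<in>I. nrm (Mon (n l) (dg l)) (bw_w (n l) (dg l)) (vel (\<gamma>s l) s) = 1)
        \<and> (\<forall>i<r. i \<noteq> l \<longrightarrow> (\<exists>f\<in>Vset (n i) (dg i). \<forall>s\<in>I. \<gamma>s i s = f))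
        \<longrightarrow> (let \<gamma> = (\<lambda>s. tensor r n dg (\<lambda>i. \<gamma>s i s)) in
              geodesic S w X I \<gamma> \<and> (\<forall>s\<in>I. nrm S w (vel \<gamma> s) = 1)
              \<and> (\<forall>t\<in>I. curvature S w X \<gamma> t = lo)))"
proof -
  interpret segre_veronese r n dg using assms(2) by unfold_locales blast
  define D where "D = real (\<Sum>i<r. dg i)"
  define dl where "dl = real (Min (dg ` {..<r}))"
  have "r \<noteq> 0" using assms(3) by (cases "r = 0") auto
  have D: "D \<ge> 2" "D = (\<Sum>i<r. real (dg i))"
    using assms(3) unfolding D_def by (metis of_nat_le_iff of_nat_numeral, simp)
  have "Min (dg ` {..<r}) \<in> dg ` {..<r}" using \<open>r \<noteq> 0\<close> by (intro Min_in) auto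
  then have dl: "dl \<ge> 1" using assms(2) by (auto simp: dl_def)
  have dl_le: "dl \<le> real (dg i)" if "i < r" for i using that by (simp add: dl_def)
  \<comment> \<open>Both bounds are brought into the shape of the curvature formula, so they amount
    to bounds \<open>1 / D\<close> and \<open>1 / dl\<close> on the sum of squares.\<close>
  have up: "2 * (D - 1) / D = 2 - 2 * (1 / D)" using D by (simp add: field_simps)
  have lo: "2 * (dl - 1) / dl = 2 - 2 * (1 / dl)" using dl by (simp add: field_simps)
  have bounds: "sqrt (2 * (dl - 1) / dl) \<le> curvature S w X \<gamma> t \<and> curvature S w X \<gamma> t \<le> sqrt (2 * (D - 1) / D)"
    if geo: "geodesic S w X I \<gamma>" and unit: "\<forall>s\<in>I. nrm S w (vel \<gamma> s) = 1" and t: "t \<in> I" for I \<gamma> t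
  proof -
    have u: "nrm S w (vel \<gamma> t) = 1" using unit t by blast
    obtain \<theta> where th: "\<And>i. i < r \<Longrightarrow> \<theta> i \<ge> 0" "(\<Sum>i<r. real (dg i) * \<theta> i) = 1"
      "curvature S w X \<gamma> t = sqrt (2 - 2 * (\<Sum>i<r. real (dg i) * (\<theta> i)\<^sup>2))"
      by (rule curvature_formula[OF geo t u]) blast
    have "1 / D \<le> (\<Sum>i<r. real (dg i) * (\<theta> i)\<^sup>2)" "(\<Sum>i<r. real (dg i) * (\<theta> i)\<^sup>2) \<le> 1 / dl"
      unfolding D(2) using weighted_squares_bounds[of r dl "\<lambda>i. real (dg i)" \<theta>] dl_le dl th by auto
    then show ?thesis unfolding up lo th(3) by simp
  qed
  have upper: "geodesic S w X I (\<lambda>s. tensor r n dg (\<lambda>i. \<gamma>s i s)) \<and>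
      (\<forall>s\<in>I. nrm S w (vel (\<lambda>s. tensor r n dg (\<lambda>i. \<gamma>s i s)) s) = 1) \<and>
      (\<forall>t\<in>I. curvature S w X (\<lambda>s. tensor r n dg (\<lambda>i. \<gamma>s i s)) t = sqrt (2 * (D - 1) / D))"
    if geo: "\<forall>i<r. geodesic (Mon (n i) (dg i)) (bw_w (n i) (dg i)) (Vset (n i) (dg i)) I (\<gamma>s i)
      \<and> (\<forall>s\<in>I. nrm (Mon (n i) (dg i)) (bw_w (n i) (dg i)) (vel (\<gamma>s i) s) = sqrt (real (dg i) / D))" for I \<gamma>s
  proof -
    have "(\<Sum>i<r. (sqrt (real (dg i) / D))\<^sup>2) = 1"
      using D by (simp add: sum_divide_distrib[symmetric])
    note tg = tensor_geodesic[of I \<gamma>s "\<lambda>i. sqrt (real (dg i) / D)", OF _ _ this]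
    \<comment> \<open>Speeds proportional to the roots of the degrees make all \<theta> i equal to
      \<open>1 / D\<close>, the equality case of the variance bound.\<close>
    have "sqrt (real (dg i) / D) ^ 4 / real (dg i) = (1 / D\<^sup>2) * real (dg i)" if "i < r" for i
    proof -
      have "sqrt (real (dg i) / D) ^ 4 = ((sqrt (real (dg i) / D))\<^sup>2)\<^sup>2" by (simp add: power_mult[symmetric])
      also have "\<dots> = (real (dg i) / D)\<^sup>2" using D by simp
      finally show ?thesis using d_ge_1[OF that] by (simp add: power2_eq_square)
    qed
    then have "(\<Sum>i<r. sqrt (real (dg i) / D) ^ 4 / real (dg i)) = (\<Sum>i<r. (1 / D\<^sup>2) * real (dg i))"
      by (intro sum.cong) auto
    also have "\<dots> = 1 / D"
      unfolding sum_distrib_left[symmetric] D(2)[symmetric] using D by (simp add: power2_eq_square)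
    finally show ?thesis using tg geo unfolding up by simp
  qed
  have lower: "geodesic S w X I (\<lambda>s. tensor r n dg (\<lambda>i. \<gamma>s i s)) \<and>
      (\<forall>s\<in>I. nrm S w (vel (\<lambda>s. tensor r n dg (\<lambda>i. \<gamma>s i s)) s) = 1) \<and>
      (\<forall>t\<in>I. curvature S w X (\<lambda>s. tensor r n dg (\<lambda>i. \<gamma>s i s)) t = sqrt (2 * (dl - 1) / dl))"
    if l: "l < r" "real (dg l) = dl"
      and geo: "geodesic (Mon (n l) (dg l)) (bw_w (n l) (dg l)) (Vset (n l) (dg l)) I (\<gamma>s l)"
      and unit: "\<forall>s\<in>I. nrm (Mon (n l) (dg l)) (bw_w (n l) (dg l)) (vel (\<gamma>s l) s) = 1"
      and const: "\<forall>i<r. i \<noteq> l \<longrightarrow> (\<exists>f\<in>Vset (n i) (dg i). \<forall>s\<in>I. \<gamma>s i s = f)" for I \<gamma>s l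
  proof -
    \<comment> \<open>All the speed sits in the factor of minimal degree, so the fourth power sum
      collapses to \<open>1 / dl\<close>.\<close>
    define \<rho> :: "nat \<Rightarrow> real" where "\<rho> i = (if i = l then 1 else 0)" for i
    have I: "open I" using geo by (simp add: geodesic_def)
    have *: "geodesic (Mon (n i) (dg i)) (bw_w (n i) (dg i)) (Vset (n i) (dg i)) I (\<gamma>s i)
      \<and> (\<forall>s\<in>I. nrm (Mon (n i) (dg i)) (bw_w (n i) (dg i)) (vel (\<gamma>s i) s) = \<rho> i)" if "i < r" for i
    proof (cases "i = l")
      case False
      then obtain f where "f \<in> Vset (n i) (dg i)" "\<And>s. s \<in> I \<Longrightarrow> \<gamma>s i s = f" using const \<open>i < r\<close> by blast
      from geodesic_const[OF I this] show ?thesis using False by (simp add: \<rho>_def)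
    qed (use geo unit in \<open>simp add: \<rho>_def\<close>)
    have "(\<rho> i)\<^sup>2 = (if i = l then 1 else 0)" "\<rho> i ^ 4 / real (dg i) = (if i = l then 1 / dl else 0)" for i
      using l(2) by (auto simp: \<rho>_def)
    then have "(\<Sum>i<r. (\<rho> i)\<^sup>2) = 1" and "(\<Sum>i<r. \<rho> i ^ 4 / real (dg i)) = 1 / dl"
      using l(1) by simp_all
    then show ?thesis using tensor_geodesic[of I \<gamma>s \<rho>] * unfolding lo by simp
  qed
  show ?thesis
    unfolding Let_def D_def[symmetric] dl_def[symmetric] using bounds upper lower by blast
qed

end
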